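(* Let $\mathbf{DirIrrPFrm}$ be the category whose objects are the directedly generated preframes and whose arrows $\mathcal{D}\to\mathcal{D}'$ are the preframe homomorphisms $f$ such that the frame homomorphism $A(f):\mathrm{Id}_{J_{\mathcal{D}}}(\mathcal{D})\to\mathrm{Id}_{J_{\mathcal{D}'}}(\mathcal{D}')$, sending $I$ to the $J_{\mathcal{D}'}$-ideal generated by $f(I)$, preserves arbitrary infima. Let $\mathbf{Pos}_{dir}$ be the category whose objects are the posets $\mathcal{P}$ such that $\mathrm{Id}_{dir}(\mathcal{P})$ is closed in $\mathrm{Id}(\mathcal{P})$ under finite meets (including the empty one), and whose arrows $\mathcal{P}\to\mathcal{P}'$ are the monotone maps $g$ such that $g^{-1}:\mathrm{Id}(\mathcal{P}')\to\mathrm{Id}(\mathcal{P})$ sends $\mathrm{Id}_{dir}(\mathcal{P}')$ into $\mathrm{Id}_{dir}(\mathcal{P})$. Let $D:\mathbf{DirIrrPFrm}^{\mathrm{op}}\to\mathbf{Pos}_{dir}$ be the functor sending $\mathcal{D}$ to the poset $\mathrm{DirIrr}(\mathcal{D})$ of its directedly irreducible elements and $f:\mathcal{D}\to\mathcal{D}'$ to the restriction $\mathrm{DirIrr}(\mathcal{D}')\to\mathrm{DirIrr}(\mathcal{D})$ of the left adjoint of $A(f)$ (elements being identified with the principal ideals they generate). Let $E:\mathbf{Pos}_{dir}\to\mathbf{DirIrrPFrm}^{\mathrm{op}}$ be the functor sending $\mathcal{P}$ to $\mathrm{Id}_{dir}(\mathcal{P})$ and $g:\mathcal{P}\to\mathcal{P}'$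 to the restriction $\mathrm{Id}_{dir}(\mathcal{P}')\to\mathrm{Id}_{dir}(\mathcal{P})$ of $g^{-1}$. Then, via $D$ and $E$, the categories $\mathbf{DirIrrPFrm}$ and $\mathbf{Pos}_{dir}$ are dual to each other.
   Context: A preframe is a poset with finite meets (including a top element) and directed joins in which finite meets distribute over directed joins; preframe homomorphisms preserve finite meets and directed joins. Directed families are non-empty. An element $d$ of a preframe $\mathcal{D}$ is directedly irreducible if whenever $d=\bigvee_{i\in I}a_i$ for a directed family $\{a_i\}$ there is $i$ with $d=a_i$; $\mathcal{D}$ is directedly generated if every element is a directed join of directedly irreducible elements. $J_{\mathcal{D}}$ is the directed topology on $\mathcal{D}$: covering sieves on $p$ are those containing a directed family with join $p$; a $J_{\mathcal{D}}$-ideal is thus a lower set containing an element $p$ whenever it contains all elements of a covering sieve on $p$, and $\mathrm{Id}_{J_{\mathcal{D}}}(\mathcal{D})$ is the frame of these ordered by inclusion. For a poset $\mathcal{P}$, $\mathrm{Id}(\mathcal{P})$ is the frame of lower sets of $\mathcal{P}$ and $\mathrm{Id}_{dir}(\mathcal{P})$ is the poset of (non-empty) directed lower sets of $\mathcal{P}$, ordered by inclusion. *)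

theory Defs
  imports "HOL-Algebra.Galois_Connection"
begin

section \<open>Preframes and ideals\<close>

text \<open>
  Posets are the records of type \<open>'a gorder\<close> satisfying \<open>partial_order\<close> of HOL-Algebra, that is,
  a carrier set in the type \<open>'a\<close> with an order on it. Directed families are represented by their
  sets of values.
\<close>

definition directed :: "('a, 'm) gorder_scheme \<Rightarrow> 'a set \<Rightarrow> bool" where
  "directed P S \<longleftrightarrow> S \<subseteq> carrier P \<and> S \<noteq> {} \<and>
     (\<forall>x\<in>S. \<forall>y\<in>S. \<exists>z\<in>S. x \<sqsubseteq>\<^bsub>P\<^esub> z \<and> y \<sqsubseteq>\<^bsub>P\<^esub> z)"

locale preframe = lower_semilattice L + weak_partial_order_top L for L (structure) +
  assumes directed_sup_exists: "directed L S \<Longrightarrow> \<exists>s. is_lub L s S"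
    and meet_directed_sup:
      "\<lbrakk>x \<in> carrier L; directed L S\<rbrakk> \<Longrightarrow> x \<sqinter> (\<Squnion>S) = \<Squnion>((\<lambda>s. x \<sqinter> s) ` S)"

definition preframe_hom :: "'a gorder \<Rightarrow> 'b gorder \<Rightarrow> ('a \<Rightarrow> 'b) \<Rightarrow> bool" where
  "preframe_hom D D' f \<longleftrightarrow> preframe D \<and> preframe D' \<and>
     f \<in> carrier D \<rightarrow> carrier D' \<and>
     f \<top>\<^bsub>D\<^esub> = \<top>\<^bsub>D'\<^esub> \<and>
     (\<forall>x\<in>carrier D. \<forall>y\<in>carrier D. f (x \<sqinter>\<^bsub>D\<^esub> y) = f x \<sqinter>\<^bsub>D'\<^esub> f y) \<and>
     (\<forall>S. directed D S \<longrightarrow> is_lub D' (f (\<Squnion>\<^bsub>D\<^esub>S)) (f ` S))"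

definition directedly_irreducible :: "'a gorder \<Rightarrow> 'a \<Rightarrow> bool" where
  "directedly_irreducible D d \<longleftrightarrow>
     d \<in> carrier D \<and> (\<forall>S. directed D S \<and> is_lub D d S \<longrightarrow> d \<in> S)"

definition DirIrr :: "'a gorder \<Rightarrow> 'a gorder" where
  "DirIrr D = D\<lparr>carrier := {d. directedly_irreducible D d}\<rparr>"

definition directedly_generated :: "'a gorder \<Rightarrow> bool" where
  "directedly_generated D \<longleftrightarrow>
     (\<forall>d\<in>carrier D. \<exists>S. S \<subseteq> carrier (DirIrr D) \<and> directed D S \<and> is_lub D d S)"

definition lower_set :: "'a gorder \<Rightarrow> 'a set \<Rightarrow> bool" where
  "lower_set P I \<longleftrightarrow> I \<subseteq> carrier P \<and> (\<forall>x\<in>I. \<forall>y\<in>carrier P. y \<sqsubseteq>\<^bsub>P\<^esub> x \<longrightarrow> y \<in> I)"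

definition down_set :: "'a gorder \<Rightarrow> 'a \<Rightarrow> 'a set" where
  "down_set P p = {x \<in> carrier P. x \<sqsubseteq>\<^bsub>P\<^esub> p}"

text \<open>A sieve on \<open>p\<close> in a poset is a lower set of elements below \<open>p\<close>.\<close>

definition covering_sieve :: "'a gorder \<Rightarrow> 'a \<Rightarrow> 'a set \<Rightarrow> bool" where
  "covering_sieve D p R \<longleftrightarrow> p \<in> carrier D \<and> lower_set D R \<and> R \<subseteq> down_set D p \<and>
     (\<exists>S. S \<subseteq> R \<and> directed D S \<and> is_lub D p S)"

definition J_ideal :: "'a gorder \<Rightarrow> 'a set \<Rightarrow> bool" where
  "J_ideal D I \<longleftrightarrow> lower_set D I \<and>
     (\<forall>p\<in>carrier D. \<forall>R. covering_sieve D p R \<and> R \<subseteq> I \<longrightarrow> p \<in> I)"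

definition inclusion_order :: "'a set set \<Rightarrow> 'a set gorder" where
  "inclusion_order \<A> = \<lparr>carrier = \<A>, eq = (=), le = (\<subseteq>)\<rparr>"

definition Id_J :: "'a gorder \<Rightarrow> 'a set gorder" where
  "Id_J D = inclusion_order {I. J_ideal D I}"

definition Id_low :: "'a gorder \<Rightarrow> 'a set gorder" where
  "Id_low P = inclusion_order {I. lower_set P I}"

definition Id_dir :: "'a gorder \<Rightarrow> 'a set gorder" where
  "Id_dir P = inclusion_order {I. lower_set P I \<and> directed P I}"

definition J_ideal_generated :: "'a gorder \<Rightarrow> 'a set \<Rightarrow> 'a set" where
  "J_ideal_generated D X = \<Inter>{K. J_ideal D K \<and> X \<subseteq> K}"

definition A_map :: "'b gorder \<Rightarrow> ('a \<Rightarrow> 'b) \<Rightarrow> 'a set \<Rightarrow> 'b set" where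
  "A_map D' f I = J_ideal_generated D' (f ` I)"

text \<open>The left adjoint \<open>Y \<rightarrow> X\<close> of a map \<open>h : X \<rightarrow> Y\<close>, made unique as a function by extensionality.\<close>

definition is_left_adjoint :: "'a gorder \<Rightarrow> 'b gorder \<Rightarrow> ('a \<Rightarrow> 'b) \<Rightarrow> ('b \<Rightarrow> 'a) \<Rightarrow> bool" where
  "is_left_adjoint X Y h l \<longleftrightarrow> l \<in> extensional (carrier Y) \<and>
     galois_connection \<lparr>orderA = Y, orderB = X, lower = l, upper = h\<rparr>"

definition left_adjoint :: "'a gorder \<Rightarrow> 'b gorder \<Rightarrow> ('a \<Rightarrow> 'b) \<Rightarrow> 'b \<Rightarrow> 'a" where
  "left_adjoint X Y h = (THE l. is_left_adjoint X Y h l)"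


section \<open>Categories and functors\<close>

record ('o, 'm) category =
  Obj :: "'o set"
  Arr :: "'m set"
  Dom :: "'m \<Rightarrow> 'o"
  Cod :: "'m \<Rightarrow> 'o"
  Ide :: "'o \<Rightarrow> 'm"
  Comp :: "'m \<Rightarrow> 'm \<Rightarrow> 'm"  \<comment> \<open>\<open>Comp C g f\<close> is \<open>g\<close> after \<open>f\<close>\<close>

locale category =
  fixes C :: "('o, 'm) category"
  assumes Dom_Obj: "f \<in> Arr C \<Longrightarrow> Dom C f \<in> Obj C"
    and Cod_Obj: "f \<in> Arr C \<Longrightarrow> Cod C f \<in> Obj C"
    and Ide_Arr: "X \<in> Obj C \<Longrightarrow> Ide C X \<in> Arr C"
    and Dom_Ide: "X \<in> Obj C \<Longrightarrow> Dom C (Ide C X) = X"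
    and Cod_Ide: "X \<in> Obj C \<Longrightarrow> Cod C (Ide C X) = X"
    and Comp_Arr: "\<lbrakk>f \<in> Arr C; g \<in> Arr C; Cod C f = Dom C g\<rbrakk> \<Longrightarrow> Comp C g f \<in> Arr C"
    and Dom_Comp: "\<lbrakk>f \<in> Arr C; g \<in> Arr C; Cod C f = Dom C g\<rbrakk> \<Longrightarrow> Dom C (Comp C g f) = Dom C f"
    and Cod_Comp: "\<lbrakk>f \<in> Arr C; g \<in> Arr C; Cod C f = Dom C g\<rbrakk> \<Longrightarrow> Cod C (Comp C g f) = Cod C g"
    and Comp_Ide: "f \<in> Arr C \<Longrightarrow> Comp C f (Ide C (Dom C f)) = f"
    and Ide_Comp: "f \<in> Arr C \<Longrightarrow> Comp C (Ide C (Cod C f)) f = f"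
    and Comp_assoc:
      "\<lbrakk>f \<in> Arr C; g \<in> Arr C; h \<in> Arr C; Cod C f = Dom C g; Cod C g = Dom C h\<rbrakk>
       \<Longrightarrow> Comp C h (Comp C g f) = Comp C (Comp C h g) f"

definition op_cat :: "('o, 'm) category \<Rightarrow> ('o, 'm) category" where
  "op_cat C = \<lparr>Obj = Obj C, Arr = Arr C, Dom = Cod C, Cod = Dom C, Ide = Ide C,
               Comp = (\<lambda>g f. Comp C f g)\<rparr>"

locale cat_functor = source: category A + target: category B
  for A :: "('o, 'm) category" and B :: "('p, 'n) category" +
  fixes F0 :: "'o \<Rightarrow> 'p" and F1 :: "'m \<Rightarrow> 'n"
  assumes F0_Obj: "X \<in> Obj A \<Longrightarrow> F0 X \<in> Obj B"
    and F1_Arr: "f \<in> Arr A \<Longrightarrow> F1 f \<in> Arr B"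
    and Dom_F1: "f \<in> Arr A \<Longrightarrow> Dom B (F1 f) = F0 (Dom A f)"
    and Cod_F1: "f \<in> Arr A \<Longrightarrow> Cod B (F1 f) = F0 (Cod A f)"
    and F1_Ide: "X \<in> Obj A \<Longrightarrow> F1 (Ide A X) = Ide B (F0 X)"
    and F1_Comp: "\<lbrakk>f \<in> Arr A; g \<in> Arr A; Cod A f = Dom A g\<rbrakk>
                   \<Longrightarrow> F1 (Comp A g f) = Comp B (F1 g) (F1 f)"


section \<open>The two categories\<close>

text \<open>
  Arrows carry their source and target, and their underlying functions are extensional, so that
  equality of arrows is equality on the carrier. Source and target may have carriers in different
  types: \<open>Id_dir\<close> sends posets over \<open>'a\<close> to posets over \<open>'a set\<close>, and the components of the natural
  isomorphisms have to relate the two.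
\<close>

record ('a, 'b) arrow =
  src :: "'a gorder"
  tgt :: "'b gorder"
  app :: "'a \<Rightarrow> 'b"

definition arrow_id :: "'a gorder \<Rightarrow> ('a, 'a) arrow" where
  "arrow_id P = \<lparr>src = P, tgt = P, app = (\<lambda>x\<in>carrier P. x)\<rparr>"

definition arrow_comp :: "('b, 'c) arrow \<Rightarrow> ('a, 'b) arrow \<Rightarrow> ('a, 'c) arrow" where
  "arrow_comp g f = \<lparr>src = src f, tgt = tgt g, app = compose (carrier (src f)) (app g) (app f)\<rparr>"

definition inverse_arrows :: "('a, 'b) arrow \<Rightarrow> ('b, 'a) arrow \<Rightarrow> bool" where
  "inverse_arrows f g \<longleftrightarrow> src g = tgt f \<and> tgt g = src f \<and>
     arrow_comp g f = arrow_id (src f) \<and> arrow_comp f g = arrow_id (tgt f)"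

definition DirIrrPFrm_obj :: "'a gorder \<Rightarrow> bool" where
  "DirIrrPFrm_obj D \<longleftrightarrow> preframe D \<and> directedly_generated D"

definition DirIrrPFrm_arr :: "('a, 'b) arrow \<Rightarrow> bool" where
  "DirIrrPFrm_arr f \<longleftrightarrow> DirIrrPFrm_obj (src f) \<and> DirIrrPFrm_obj (tgt f) \<and>
     app f \<in> extensional (carrier (src f)) \<and>
     preframe_hom (src f) (tgt f) (app f) \<and>
     inf_pres (Id_J (src f)) (Id_J (tgt f)) (A_map (tgt f) (app f))"

definition DirIrrPFrm_iso :: "('a, 'b) arrow \<Rightarrow> bool" where
  "DirIrrPFrm_iso f \<longleftrightarrow> DirIrrPFrm_arr f \<and> (\<exists>g. DirIrrPFrm_arr g \<and> inverse_arrows f g)"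

definition DirIrrPFrm :: "('a gorder, ('a, 'a) arrow) category" where
  "DirIrrPFrm = \<lparr>Obj = {D. DirIrrPFrm_obj D}, Arr = {f. DirIrrPFrm_arr f},
                 Dom = src, Cod = tgt, Ide = arrow_id, Comp = arrow_comp\<rparr>"

definition inverse_image :: "'a gorder \<Rightarrow> ('a \<Rightarrow> 'b) \<Rightarrow> 'b set \<Rightarrow> 'a set" where
  "inverse_image P g I = {p \<in> carrier P. g p \<in> I}"

text \<open>Meets are those of \<open>Id_low P\<close>; the empty one is the whole carrier.\<close>

definition Pos_dir_obj :: "'a gorder \<Rightarrow> bool" where
  "Pos_dir_obj P \<longleftrightarrow> partial_order P \<and>
     (\<forall>F. finite F \<and> F \<subseteq> carrier (Id_dir P) \<longrightarrow> \<Sqinter>\<^bsub>Id_low P\<^esub>F \<in> carrier (Id_dir P))"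

definition Pos_dir_arr :: "('a, 'b) arrow \<Rightarrow> bool" where
  "Pos_dir_arr g \<longleftrightarrow> Pos_dir_obj (src g) \<and> Pos_dir_obj (tgt g) \<and>
     app g \<in> extensional (carrier (src g)) \<and>
     app g \<in> carrier (src g) \<rightarrow> carrier (tgt g) \<and> isotone (src g) (tgt g) (app g) \<and>
     inverse_image (src g) (app g) \<in> carrier (Id_dir (tgt g)) \<rightarrow> carrier (Id_dir (src g))"

definition Pos_dir_iso :: "('a, 'b) arrow \<Rightarrow> bool" where
  "Pos_dir_iso f \<longleftrightarrow> Pos_dir_arr f \<and> (\<exists>g. Pos_dir_arr g \<and> inverse_arrows f g)"

definition Pos_dir :: "('a gorder, ('a, 'a) arrow) category" where
  "Pos_dir = \<lparr>Obj = {P. Pos_dir_obj P}, Arr = {g. Pos_dir_arr g},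
              Dom = src, Cod = tgt, Ide = arrow_id, Comp = arrow_comp\<rparr>"


section \<open>The functors\<close>

definition A_left_adjoint :: "('a, 'b) arrow \<Rightarrow> 'b set \<Rightarrow> 'a set" where
  "A_left_adjoint f = left_adjoint (Id_J (src f)) (Id_J (tgt f)) (A_map (tgt f) (app f))"

definition D_obj :: "'a gorder \<Rightarrow> 'a gorder" where
  "D_obj D = DirIrr D"

definition D_arr :: "('a, 'b) arrow \<Rightarrow> ('b, 'a) arrow" where
  "D_arr f = \<lparr>src = DirIrr (tgt f), tgt = DirIrr (src f),
     app = (\<lambda>d'\<in>carrier (DirIrr (tgt f)).
       THE d. d \<in> carrier (DirIrr (src f)) \<and>
              A_left_adjoint f (down_set (tgt f) d') = down_set (src f) d)\<rparr>"

definition E_obj :: "'a gorder \<Rightarrow> 'a set gorder" where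
  "E_obj P = Id_dir P"

definition E_arr :: "('a, 'b) arrow \<Rightarrow> ('b set, 'a set) arrow" where
  "E_arr g = \<lparr>src = Id_dir (tgt g), tgt = Id_dir (src g),
     app = (\<lambda>I\<in>carrier (Id_dir (tgt g)). inverse_image (src g) (app g) I)\<rparr>"

end

theory Submission
  imports Defs
begin

text \<open>
  Everything rests on one property: a directedly irreducible element \<open>p\<close> of a preframe is compact. If
  \<open>p\<close> lies below the join of a directed set \<open>S\<close>, then \<open>p\<close> is the directed join of the meets
  \<open>p \<sqinter> s\<close>, hence equal to one of them, hence below some \<open>s \<in> S\<close>
  (\<open>irreducible_le_directed_lub\<close>).
  
  Let \<open>D\<close> be directedly generated. An element \<open>d\<close> is the join of the irreducible elements below it,
  and by compactness these form a directed lower set of \<open>DirIrr D\<close>; conversely every directed lower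
  set \<open>I\<close> of \<open>DirIrr D\<close> consists exactly of the irreducible elements below \<open>\<Squnion>I\<close>
  (\<open>irreducibles_below_sup\<close>). So \<open>D\<close> is isomorphic to \<open>Id_dir (DirIrr D)\<close>. In the same way a
  \<open>J\<close>-ideal is determined by its irreducible elements (\<open>J_ideal_eqI\<close>). In the other direction,
  every directed lower set of a poset \<open>P\<close> is the directed union of the principal ideals of its
  elements, so the irreducible elements of \<open>Id_dir P\<close> are the principal ideals
  (\<open>irreducible_Id_dir_iff\<close>), and \<open>P\<close> is isomorphic to \<open>DirIrr (Id_dir P)\<close>.
  
  For the arrows, the point is to replace the condition on \<open>A(f)\<close> by one about elements. Write \<open>\<down>x\<close>
  for the principal ideal of \<open>x\<close>. An irreducible \<open>q\<close> lies in \<open>A(f)(I)\<close> if and only if \<open>q \<le> f p\<close>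
  for some irreducible \<open>p \<in> I\<close> (\<open>irreducible_mem_A_map\<close>). If \<open>A(f)\<close> has a left adjoint \<open>l\<close>, apply
  this to \<open>I = l(\<down>q)\<close>: the resulting \<open>p\<close> satisfies \<open>\<down>p \<subseteq> l(\<down>q)\<close>, and also \<open>\<down>q \<subseteq> A(f)(\<down>p)\<close>,
  whence \<open>l(\<down>q) = \<down>p\<close>. Thus \<open>l\<close> restricts to a map \<open>g\<close> on irreducible elements with
  \<open>g q \<le> d \<longleftrightarrow> q \<le> f d\<close> for all \<open>d\<close> (\<open>D_arr_irr_adjoint\<close>). Conversely, a map of carriers \<open>f\<close> that
  admits such a \<open>g\<close> is a preframe homomorphism, and \<open>A(f)\<close> preserves infima because
  \<open>q \<in> A(f)(I) \<longleftrightarrow> g q \<in> I\<close> (\<open>irr_adjoint_preframe_hom\<close>, \<open>irr_adjoint_inf_pres\<close>). With this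
  criterion, closure under composition and functoriality come down to composing the maps \<open>g\<close>. For
  \<open>g\<close> in \<open>Pos_dir\<close> the map \<open>\<down>p \<mapsto> \<down>(g p)\<close> is the required adjoint of \<open>E(g)\<close>
  (\<open>E_arr_irr_adjoint\<close>), and for \<open>f\<close> in \<open>DirIrrPFrm\<close> the preimage under \<open>D(f)\<close> of the irreducible
  elements below \<open>d\<close> is the set of those below \<open>f d\<close> (\<open>inverse_image_D_arr\<close>). These two formulas show
  that \<open>D\<close> and \<open>E\<close> are well defined on arrows, and they are also the naturality squares.
\<close>

section \<open>Bounds in posets and left adjoints\<close>

lemma is_lub_iff:
  assumes "S \<subseteq> carrier L"
  shows "is_lub L s S \<longleftrightarrow> s \<in> carrier L \<and> (\<forall>x\<in>S. x \<sqsubseteq>\<^bsub>L\<^esub> s) \<and>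
    (\<forall>u\<in>carrier L. (\<forall>x\<in>S. x \<sqsubseteq>\<^bsub>L\<^esub> u) \<longrightarrow> s \<sqsubseteq>\<^bsub>L\<^esub> u)"
  using assms unfolding least_def Upper_def by blast

lemma is_glb_iff:
  assumes "S \<subseteq> carrier L"
  shows "is_glb L s S \<longleftrightarrow> s \<in> carrier L \<and> (\<forall>x\<in>S. s \<sqsubseteq>\<^bsub>L\<^esub> x) \<and>
    (\<forall>u\<in>carrier L. (\<forall>x\<in>S. u \<sqsubseteq>\<^bsub>L\<^esub> x) \<longrightarrow> u \<sqsubseteq>\<^bsub>L\<^esub> s)"
  using assms unfolding greatest_def Lower_def by blast

lemma (in partial_order) sup_eqI: "is_lub L s S \<Longrightarrow> \<Squnion>S = s"
  unfolding sup_def by (rule some_equality) (auto intro: least_unique)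

lemma (in partial_order) inf_eqI: "is_glb L s S \<Longrightarrow> \<Sqinter>S = s"
  unfolding inf_def by (rule some_equality) (auto intro: greatest_unique)

lemma carrier_inclusion_order [simp]: "carrier (inclusion_order \<A>) = \<A>"
  and le_inclusion_order [simp]: "le (inclusion_order \<A>) = (\<subseteq>)"
  by (simp_all add: inclusion_order_def)

lemma partial_order_inclusion_order: "partial_order (inclusion_order \<A>)"
  by unfold_locales (auto simp: inclusion_order_def)

lemma carrier_Id_J [simp]: "carrier (Id_J D) = {I. J_ideal D I}"
  and le_Id_J [simp]: "le (Id_J D) = (\<subseteq>)"
  and carrier_Id_low [simp]: "carrier (Id_low P) = {I. lower_set P I}"
  and carrier_Id_dir [simp]: "carrier (Id_dir P) = {I. lower_set P I \<and> directed P I}"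
  and le_Id_dir [simp]: "le (Id_dir P) = (\<subseteq>)"
  by (simp_all add: Id_J_def Id_low_def Id_dir_def)

lemma le_DirIrr [simp]: "le (DirIrr D) = le D"
  and carrier_DirIrr [simp]: "carrier (DirIrr D) = {d. directedly_irreducible D d}"
  and eq_DirIrr [simp]: "eq (DirIrr D) = eq D"
  by (simp_all add: DirIrr_def)

lemma lower_set_subset: "lower_set P I \<Longrightarrow> I \<subseteq> carrier P"
  and lower_setD: "\<lbrakk>lower_set P I; x \<in> I; y \<in> carrier P; y \<sqsubseteq>\<^bsub>P\<^esub> x\<rbrakk> \<Longrightarrow> y \<in> I"
  unfolding lower_set_def by blast+

lemma J_ideal_lower_set: "J_ideal D I \<Longrightarrow> lower_set D I"
  unfolding J_ideal_def by (rule conjunct1)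

lemma is_left_adjoint_iff:
  "is_left_adjoint X Y h l \<longleftrightarrow> l \<in> extensional (carrier Y) \<and> partial_order X \<and> partial_order Y \<and>
     l \<in> carrier Y \<rightarrow> carrier X \<and> h \<in> carrier X \<rightarrow> carrier Y \<and>
     (\<forall>x\<in>carrier Y. \<forall>y\<in>carrier X. l x \<sqsubseteq>\<^bsub>X\<^esub> y \<longleftrightarrow> x \<sqsubseteq>\<^bsub>Y\<^esub> h y)"
  unfolding is_left_adjoint_def galois_connection_def connection_def galois_connection_axioms_def
  by auto

lemma is_left_adjoint_left_adjoint:
  assumes "is_left_adjoint X Y h l"
  shows "is_left_adjoint X Y h (left_adjoint X Y h)"
  unfolding left_adjoint_def
proof (rule theI[of "is_left_adjoint X Y h" l])
  show "is_left_adjoint X Y h l" by fact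
next
  fix k assume k: "is_left_adjoint X Y h k"
  interpret X: partial_order X using assms by (simp add: is_left_adjoint_iff)
  show "k = l"
  proof (rule extensionalityI)
    show "k \<in> extensional (carrier Y)" "l \<in> extensional (carrier Y)"
      using k assms by (simp_all add: is_left_adjoint_iff)
    fix x assume x: "x \<in> carrier Y"
    then have "k x \<in> carrier X" "l x \<in> carrier X"
      using k assms by (auto simp: is_left_adjoint_iff)
    then show "k x = l x"
      using k assms x unfolding is_left_adjoint_iff by (meson X.le_antisym X.le_refl)
  qed
qed

text \<open>
  The adjoint functor theorem for posets: the left adjoint takes \<open>y\<close> to the infimum of all \<open>x\<close> with
  \<open>y \<sqsubseteq> h x\<close>, and preservation of this infimum is the unit inequality.
\<close>

lemma inf_pres_left_adjoint:
  assumes h: "h \<in> carrier X \<rightarrow> carrier Y" and pres: "inf_pres X Y h"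
  shows "is_left_adjoint X Y h (left_adjoint X Y h)"
proof -
  interpret X: complete_lattice X using pres by (simp add: inf_pres_def)
  interpret Y: complete_lattice Y using pres by (simp add: inf_pres_def)
  define above where "above y = {x \<in> carrier X. y \<sqsubseteq>\<^bsub>Y\<^esub> h x}" for y
  have above: "above y \<subseteq> carrier X" for y by (auto simp: above_def)
  have him: "h ` above y \<subseteq> carrier Y" for y using h by (auto simp: above_def)
  have hinf: "h (\<Sqinter>\<^bsub>X\<^esub> A) = \<Sqinter>\<^bsub>Y\<^esub> (h ` A)" if "A \<subseteq> carrier X" for A
    using pres that by (simp add: inf_pres_def)
  have mono: "h x \<sqsubseteq>\<^bsub>Y\<^esub> h x'" if "x \<in> carrier X" "x' \<in> carrier X" "x \<sqsubseteq>\<^bsub>X\<^esub> x'" for x x'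
  proof -
    \<comment> \<open>Monotonicity follows because \<open>x\<close> is the infimum of \<open>{x, x'}\<close>.\<close>
    have xx: "{x, x'} \<subseteq> carrier X" using that by simp
    have "is_glb X x {x, x'}" unfolding is_glb_iff[OF xx] using that by simp
    then have "h x = \<Sqinter>\<^bsub>Y\<^esub> (h ` {x, x'})" using hinf[OF xx] by (simp only: X.inf_eqI)
    moreover have "h ` {x, x'} \<subseteq> carrier Y" using h that by blast
    ultimately show ?thesis using Y.weak.inf_lower[of "h ` {x, x'}" "h x'"] by simp
  qed
  have unit: "y \<sqsubseteq>\<^bsub>Y\<^esub> h (\<Sqinter>\<^bsub>X\<^esub> (above y))" if "y \<in> carrier Y" for y
    unfolding hinf[OF above]
    by (rule Y.weak.inf_greatest[OF him that]) (auto simp: above_def)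
  have "is_left_adjoint X Y h (\<lambda>y\<in>carrier Y. \<Sqinter>\<^bsub>X\<^esub> (above y))"
    unfolding is_left_adjoint_iff
  proof (intro conjI ballI)
    fix y x assume y: "y \<in> carrier Y" and x: "x \<in> carrier X"
    have c: "\<Sqinter>\<^bsub>X\<^esub> (above y) \<in> carrier X" using above by (rule X.weak.inf_closed)
    show "(\<lambda>y\<in>carrier Y. \<Sqinter>\<^bsub>X\<^esub> (above y)) y \<sqsubseteq>\<^bsub>X\<^esub> x \<longleftrightarrow> y \<sqsubseteq>\<^bsub>Y\<^esub> h x"
    proof
      assume "(\<lambda>y\<in>carrier Y. \<Sqinter>\<^bsub>X\<^esub> (above y)) y \<sqsubseteq>\<^bsub>X\<^esub> x"
      then have "h (\<Sqinter>\<^bsub>X\<^esub> (above y)) \<sqsubseteq>\<^bsub>Y\<^esub> h x" using mono c x y by simp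
      moreover have "h (\<Sqinter>\<^bsub>X\<^esub> (above y)) \<in> carrier Y" "h x \<in> carrier Y"
        using h c x by blast+
      ultimately show "y \<sqsubseteq>\<^bsub>Y\<^esub> h x" using Y.le_trans[OF unit[OF y]] y by blast
    next
      assume "y \<sqsubseteq>\<^bsub>Y\<^esub> h x"
      then show "(\<lambda>y\<in>carrier Y. \<Sqinter>\<^bsub>X\<^esub> (above y)) y \<sqsubseteq>\<^bsub>X\<^esub> x"
        using y x X.weak.inf_lower[OF above, of x y] by (simp add: above_def)
    qed
  next
    show "(\<lambda>y\<in>carrier Y. \<Sqinter>\<^bsub>X\<^esub> (above y)) \<in> carrier Y \<rightarrow> carrier X"
      using X.weak.inf_closed[OF above] by simp
  qed (use h X.partial_order_axioms Y.partial_order_axioms in simp_all)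
  then show ?thesis by (rule is_left_adjoint_left_adjoint)
qed

section \<open>Directedly irreducible elements and ideals of a preframe\<close>

context preframe
begin

lemma is_lub_directed_sup: "directed L S \<Longrightarrow> is_lub L (\<Squnion>S) S"
  using directed_sup_exists sup_eqI by metis

lemma le_meet_iff:
  "\<lbrakk>x \<in> carrier L; y \<in> carrier L; z \<in> carrier L\<rbrakk> \<Longrightarrow> z \<sqsubseteq> x \<sqinter> y \<longleftrightarrow> z \<sqsubseteq> x \<and> z \<sqsubseteq> y"
  by (meson le_trans weak.meet_closed weak.meet_le weak.meet_left weak.meet_right)

lemma meet_absorb: "\<lbrakk>x \<in> carrier L; y \<in> carrier L\<rbrakk> \<Longrightarrow> x \<sqinter> y = x \<longleftrightarrow> x \<sqsubseteq> y"
  by (metis le_antisym le_meet_iff le_refl weak.meet_closed weak.meet_left weak.meet_right)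

lemma directed_meet:
  assumes "x \<in> carrier L" "directed L S"
  shows "directed L ((\<lambda>s. x \<sqinter> s) ` S)"
  unfolding directed_def
proof (intro conjI ballI)
  have S: "S \<subseteq> carrier L" using assms by (simp add: directed_def)
  show "(\<lambda>s. x \<sqinter> s) ` S \<subseteq> carrier L" using S assms by auto
  show "(\<lambda>s. x \<sqinter> s) ` S \<noteq> {}" using assms by (auto simp: directed_def)
  fix u v assume "u \<in> (\<lambda>s. x \<sqinter> s) ` S" "v \<in> (\<lambda>s. x \<sqinter> s) ` S"
  then obtain s t where st: "s \<in> S" "t \<in> S" "u = x \<sqinter> s" "v = x \<sqinter> t" by auto
  then obtain w where w: "w \<in> S" "s \<sqsubseteq> w" "t \<sqsubseteq> w"
    using assms(2) unfolding directed_def by blast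
  \<comment> \<open>Meet with \<open>x\<close> is monotone, so an upper bound of \<open>s\<close> and \<open>t\<close> serves for both meets.\<close>
  have *: "x \<sqinter> r \<sqsubseteq> x \<sqinter> w" if "r \<in> S" "r \<sqsubseteq> w" for r
  proof -
    have c: "r \<in> carrier L" "w \<in> carrier L" using S that w by auto
    have "x \<sqinter> r \<sqsubseteq> r" using c assms(1) by (simp add: weak.meet_right)
    then have "x \<sqinter> r \<sqsubseteq> w" using le_trans[OF _ \<open>r \<sqsubseteq> w\<close>] c assms(1) by simp
    then show ?thesis using c assms(1) by (simp add: le_meet_iff weak.meet_left)
  qed
  show "\<exists>z\<in>(\<lambda>s. x \<sqinter> s) ` S. u \<sqsubseteq> z \<and> v \<sqsubseteq> z"
    unfolding st using *[OF st(1) w(2)] *[OF st(2) w(3)] w(1) by (intro bexI[of _ "x \<sqinter> w"]) auto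
qed

end

text \<open>
  Irreducibility and the notions of ideal are defined for order records without extension fields,
  whereas \<^locale>\<open>preframe\<close> is stated for all extensions of such records.
\<close>

locale plain_preframe = preframe L for L :: "'a gorder" (structure)
begin

text \<open>
  Compactness. It comes from distributivity: \<open>p = p \<sqinter> d\<close> is the join of the directed set of all
  \<open>p \<sqinter> s\<close>, so irreducibility makes \<open>p\<close> one of these meets.
\<close>

lemma irreducible_le_directed_lub:
  assumes p: "directedly_irreducible L p" and S: "directed L S" and d: "is_lub L d S"
    and le: "p \<sqsubseteq> d"
  shows "\<exists>s\<in>S. p \<sqsubseteq> s"
proof -
  have pc: "p \<in> carrier L" using p by (simp add: directedly_irreducible_def)
  have Sc: "S \<subseteq> carrier L" using S by (simp add: directed_def)
  have dc: "d \<in> carrier L" using d by simp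
  have "\<Squnion>((\<lambda>s. p \<sqinter> s) ` S) = p"
    using meet_directed_sup[OF pc S] sup_eqI[OF d] meet_absorb[OF pc dc] le by metis
  then have "is_lub L p ((\<lambda>s. p \<sqinter> s) ` S)"
    using is_lub_directed_sup[OF directed_meet[OF pc S]] by simp
  then have "p \<in> (\<lambda>s. p \<sqinter> s) ` S"
    using p directed_meet[OF pc S] by (auto simp: directedly_irreducible_def)
  then show ?thesis using Sc pc by (metis imageE meet_absorb subsetD)
qed

text \<open>
  A lower set that contains a directed set \<open>S\<close> contains the sieve generated by \<open>S\<close>, and this sieve
  covers the join of \<open>S\<close>.
\<close>

lemma J_ideal_iff:
  "J_ideal L I \<longleftrightarrow> lower_set L I \<and> (\<forall>S d. S \<subseteq> I \<and> directed L S \<and> is_lub L d S \<longrightarrow> d \<in> I)"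
proof (intro iffI conjI allI impI)
  assume I: "J_ideal L I"
  then show low: "lower_set L I" by (simp add: J_ideal_def)
  fix S d assume S: "S \<subseteq> I \<and> directed L S \<and> is_lub L d S"
  then have Sc: "S \<subseteq> carrier L" by (simp add: directed_def)
  have lub: "d \<in> carrier L" "\<And>s. s \<in> S \<Longrightarrow> s \<sqsubseteq> d" using S Sc by (auto simp: is_lub_iff)
  \<comment> \<open>the sieve generated by \<open>S\<close>\<close>
  define R where "R = {x \<in> carrier L. \<exists>s\<in>S. x \<sqsubseteq> s}"
  have "lower_set L R" unfolding lower_set_def R_def using Sc le_trans by blast
  moreover have "R \<subseteq> down_set L d" unfolding down_set_def R_def using Sc lub le_trans by blast
  moreover have "S \<subseteq> R" unfolding R_def using Sc by blast
  ultimately have "covering_sieve L d R" using S lub by (auto simp: covering_sieve_def)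
  moreover have "R \<subseteq> I" using low S by (auto simp: R_def lower_set_def)
  ultimately show "d \<in> I" using I lub by (auto simp: J_ideal_def)
next
  assume "lower_set L I \<and> (\<forall>S d. S \<subseteq> I \<and> directed L S \<and> is_lub L d S \<longrightarrow> d \<in> I)"
  then show "J_ideal L I" unfolding J_ideal_def covering_sieve_def by blast
qed

text \<open>
  The intersection with the carrier accounts for the empty family, whose infimum is the whole carrier.
\<close>

lemma J_ideal_Inter:
  assumes "\<And>I. I \<in> \<A> \<Longrightarrow> J_ideal L I"
  shows "J_ideal L (carrier L \<inter> \<Inter>\<A>)"
  unfolding J_ideal_iff
proof (intro conjI allI impI)
  show "lower_set L (carrier L \<inter> \<Inter>\<A>)"
    using assms by (fastforce simp: J_ideal_iff lower_set_def)
  fix S d assume S: "S \<subseteq> carrier L \<inter> \<Inter>\<A> \<and> directed L S \<and> is_lub L d S"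
  have "d \<in> I" if "I \<in> \<A>" for I
    using assms[OF that] S that unfolding J_ideal_iff by (meson Inf_lower le_inf_iff order_trans)
  then show "d \<in> carrier L \<inter> \<Inter>\<A>" using S by auto
qed

lemma is_glb_Id_J:
  assumes "\<A> \<subseteq> carrier (Id_J L)"
  shows "is_glb (Id_J L) (carrier L \<inter> \<Inter>\<A>) \<A>"
  unfolding is_glb_iff[OF assms]
proof (intro conjI ballI impI)
  show "carrier L \<inter> \<Inter>\<A> \<in> carrier (Id_J L)" using J_ideal_Inter[of \<A>] assms by auto
  show "carrier L \<inter> \<Inter>\<A> \<sqsubseteq>\<^bsub>Id_J L\<^esub> I" if "I \<in> \<A>" for I using that by auto
  show "K \<sqsubseteq>\<^bsub>Id_J L\<^esub> carrier L \<inter> \<Inter>\<A>"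
    if "K \<in> carrier (Id_J L)" "\<forall>I\<in>\<A>. K \<sqsubseteq>\<^bsub>Id_J L\<^esub> I" for K
    using that by (auto simp: J_ideal_iff lower_set_def)
qed

lemma inf_Id_J: "\<A> \<subseteq> carrier (Id_J L) \<Longrightarrow> \<Sqinter>\<^bsub>Id_J L\<^esub>\<A> = carrier L \<inter> \<Inter>\<A>"
  using partial_order.inf_eqI[of "Id_J L"] is_glb_Id_J
  by (simp add: Id_J_def partial_order_inclusion_order)

lemma complete_lattice_Id_J: "complete_lattice (Id_J L)"
proof (rule partial_order.complete_lattice_criterion1)
  show "partial_order (Id_J L)" by (simp add: Id_J_def partial_order_inclusion_order)
  show "\<exists>g. greatest (Id_J L) g (carrier (Id_J L))"
    using is_glb_Id_J[of "{}"] by auto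
qed (use is_glb_Id_J in blast)

lemma J_ideal_generated:
  assumes "X \<subseteq> carrier L"
  shows "J_ideal L (J_ideal_generated L X)"
proof -
  have "J_ideal L (carrier L)" using J_ideal_Inter[of "{}"] by simp
  then have "J_ideal_generated L X = carrier L \<inter> \<Inter>{K. J_ideal L K \<and> X \<subseteq> K}"
    using assms by (auto simp: J_ideal_generated_def)
  then show ?thesis using J_ideal_Inter[of "{K. J_ideal L K \<and> X \<subseteq> K}"] by simp
qed

lemma J_ideal_down_set: "d \<in> carrier L \<Longrightarrow> J_ideal L (down_set L d)"
  unfolding J_ideal_iff
proof (intro conjI allI impI)
  assume d: "d \<in> carrier L"
  then show "lower_set L (down_set L d)" unfolding lower_set_def down_set_def using le_trans by blast
  fix S e assume S: "S \<subseteq> down_set L d \<and> directed L S \<and> is_lub L e S"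
  then have Sc: "S \<subseteq> carrier L" and Sd: "\<forall>x\<in>S. x \<sqsubseteq> d" by (auto simp: down_set_def)
  have "is_lub L e S" using S by simp
  then have "e \<in> carrier L" "e \<sqsubseteq> d" unfolding is_lub_iff[OF Sc] using d Sd by blast+
  then show "e \<in> down_set L d" by (simp add: down_set_def)
qed

end

locale directedly_generated_preframe = plain_preframe +
  assumes generated: "directedly_generated L"
begin

lemma irreducible_closed: "directedly_irreducible L p \<Longrightarrow> p \<in> carrier L"
  by (simp add: directedly_irreducible_def)

lemma irreducibles_below_subset: "down_set (DirIrr L) d \<subseteq> carrier L"
  by (auto simp: down_set_def irreducible_closed)

text \<open>
  A directed set \<open>S\<close> of irreducible elements with join \<open>d\<close> is cofinal in the set of all irreducible
  elements below \<open>d\<close>, by compactness. So the canonical set inherits directedness and the join from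
  \<open>S\<close>.
\<close>

lemma irreducibles_below_directed_and_lub:
  assumes d: "d \<in> carrier L"
  shows "directed L (down_set (DirIrr L) d) \<and> is_lub L d (down_set (DirIrr L) d)"
proof -
  obtain S where S: "S \<subseteq> {p. directedly_irreducible L p}" and dir: "directed L S" and lub: "is_lub L d S"
    using generated d by (auto simp: directedly_generated_def)
  have Sc: "S \<subseteq> carrier L" using dir by (simp add: directed_def)
  have above: "s \<sqsubseteq> d" if "s \<in> S" for s using lub that unfolding is_lub_iff[OF Sc] by blast
  have least: "d \<sqsubseteq> u" if "u \<in> carrier L" "\<forall>s\<in>S. s \<sqsubseteq> u" for u
    using lub that unfolding is_lub_iff[OF Sc] by blast
  have sub: "S \<subseteq> down_set (DirIrr L) d" using S above by (auto simp: down_set_def)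
  \<comment> \<open>cofinality of \<open>S\<close>\<close>
  have dom: "\<exists>s\<in>S. p \<sqsubseteq> s" if "p \<in> down_set (DirIrr L) d" for p
    using irreducible_le_directed_lub[OF _ dir lub] that by (auto simp: down_set_def)
  have "directed L (down_set (DirIrr L) d)"
    unfolding directed_def
  proof (intro conjI ballI)
    show "down_set (DirIrr L) d \<subseteq> carrier L" by (rule irreducibles_below_subset)
    show "down_set (DirIrr L) d \<noteq> {}" using sub dir by (auto simp: directed_def)
    fix p q assume p: "p \<in> down_set (DirIrr L) d" and q: "q \<in> down_set (DirIrr L) d"
    then obtain s t where st: "s \<in> S" "p \<sqsubseteq> s" "t \<in> S" "q \<sqsubseteq> t" using dom by meson
    then obtain z where z: "z \<in> S" "s \<sqsubseteq> z" "t \<sqsubseteq> z" using dir unfolding directed_def by blast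
    have "p \<in> carrier L" "q \<in> carrier L" using p q irreducibles_below_subset by blast+
    then have "p \<sqsubseteq> z" "q \<sqsubseteq> z"
      using le_trans[OF st(2) z(2)] le_trans[OF st(4) z(3)] st z Sc by blast+
    then show "\<exists>z\<in>down_set (DirIrr L) d. p \<sqsubseteq> z \<and> q \<sqsubseteq> z" using z sub by blast
  qed
  moreover have "is_lub L d (down_set (DirIrr L) d)"
    unfolding is_lub_iff[OF irreducibles_below_subset]
  proof (intro conjI ballI impI)
    show "p \<sqsubseteq> d" if "p \<in> down_set (DirIrr L) d" for p using that by (simp add: down_set_def)
    show "d \<sqsubseteq> u" if "u \<in> carrier L" "\<forall>p\<in>down_set (DirIrr L) d. p \<sqsubseteq> u" for u
      using least that sub by blast
  qed (rule d)
  ultimately show ?thesis by blast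
qed

lemmas irreducibles_below_directed = irreducibles_below_directed_and_lub[THEN conjunct1]
  and irreducibles_below_lub = irreducibles_below_directed_and_lub[THEN conjunct2]

lemma le_iff_irreducibles:
  assumes x: "x \<in> carrier L" and y: "y \<in> carrier L"
  shows "x \<sqsubseteq> y \<longleftrightarrow> (\<forall>p. directedly_irreducible L p \<longrightarrow> p \<sqsubseteq> x \<longrightarrow> p \<sqsubseteq> y)"
proof
  assume xy: "x \<sqsubseteq> y"
  show "\<forall>p. directedly_irreducible L p \<longrightarrow> p \<sqsubseteq> x \<longrightarrow> p \<sqsubseteq> y"
    using le_trans[OF _ xy irreducible_closed x y] by simp
next
  assume "\<forall>p. directedly_irreducible L p \<longrightarrow> p \<sqsubseteq> x \<longrightarrow> p \<sqsubseteq> y"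
  then have "\<forall>p\<in>down_set (DirIrr L) x. p \<sqsubseteq> y" by (simp add: down_set_def)
  with irreducibles_below_lub[OF x] y show "x \<sqsubseteq> y"
    unfolding is_lub_iff[OF irreducibles_below_subset] by blast
qed

lemma partial_order_DirIrr: "partial_order (DirIrr L)"
proof -
  have "weak_partial_order (DirIrr L)"
    unfolding DirIrr_def
    by (rule weak_partial_order_subset[OF weak_partial_order_axioms]) (auto simp: irreducible_closed)
  then show ?thesis by (simp add: partial_order_def partial_order_axioms_def eq_is_equal)
qed

lemma irreducibles_below_Id_dir:
  assumes d: "d \<in> carrier L"
  shows "down_set (DirIrr L) d \<in> carrier (Id_dir (DirIrr L))"
proof -
  have "lower_set (DirIrr L) (down_set (DirIrr L) d)"
    unfolding lower_set_def down_set_def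
    using le_trans[OF _ _ irreducible_closed irreducible_closed d] by simp blast
  moreover have "directed (DirIrr L) (down_set (DirIrr L) d)"
    using irreducibles_below_directed[OF d] unfolding directed_def by (auto simp: down_set_def)
  ultimately show ?thesis by simp
qed

lemma directed_DirIrr: "directed (DirIrr L) I \<Longrightarrow> directed L I"
  by (auto simp: directed_def irreducible_closed)

text \<open>
  Together with \<open>sup_irreducibles_below\<close> below, this identifies the preframe with the directed lower sets
  of its irreducible elements.
\<close>

lemma irreducibles_below_sup:
  assumes I: "I \<in> carrier (Id_dir (DirIrr L))"
  shows "down_set (DirIrr L) (\<Squnion>I) = I"
proof -
  have dir: "directed L I" using I directed_DirIrr by simp
  then have lub: "is_lub L (\<Squnion>I) I" by (rule is_lub_directed_sup)
  have Ic: "I \<subseteq> carrier L" using dir by (simp add: directed_def)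
  have irr: "directedly_irreducible L p" if "p \<in> I" for p
    using I that by (auto simp: lower_set_def)
  show ?thesis
  proof
    show "I \<subseteq> down_set (DirIrr L) (\<Squnion>I)"
      using lub irr unfolding is_lub_iff[OF Ic] by (auto simp: down_set_def)
    show "down_set (DirIrr L) (\<Squnion>I) \<subseteq> I"
    proof
      fix p assume "p \<in> down_set (DirIrr L) (\<Squnion>I)"
      then have p: "directedly_irreducible L p" "p \<sqsubseteq> \<Squnion>I" by (auto simp: down_set_def)
      then obtain s where "s \<in> I" "p \<sqsubseteq> s" using irreducible_le_directed_lub[OF _ dir lub] by blast
      then show "p \<in> I" using I p by (auto simp: lower_set_def)
    qed
  qed
qed

lemma sup_irreducibles_below: "d \<in> carrier L \<Longrightarrow> \<Squnion>(down_set (DirIrr L) d) = d"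
  by (rule sup_eqI) (rule irreducibles_below_lub)

lemma J_ideal_mem_iff:
  assumes "J_ideal L I" "d \<in> carrier L"
  shows "d \<in> I \<longleftrightarrow> down_set (DirIrr L) d \<subseteq> I"
proof
  assume "d \<in> I" then show "down_set (DirIrr L) d \<subseteq> I"
    using lower_setD[OF J_ideal_lower_set[OF assms(1)]] irreducible_closed by (auto simp: down_set_def)
next
  assume "down_set (DirIrr L) d \<subseteq> I" then show "d \<in> I"
    using assms irreducibles_below_directed irreducibles_below_lub unfolding J_ideal_iff by meson
qed

lemma J_ideal_subsetI:
  assumes I: "J_ideal L I" and K: "J_ideal L K"
    and sub: "\<And>p. \<lbrakk>directedly_irreducible L p; p \<in> I\<rbrakk> \<Longrightarrow> p \<in> K"
  shows "I \<subseteq> K"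
proof
  fix d assume d: "d \<in> I"
  then have dc: "d \<in> carrier L" using lower_set_subset[OF J_ideal_lower_set[OF I]] by blast
  then have "down_set (DirIrr L) d \<subseteq> I" using J_ideal_mem_iff[OF I] d by simp
  then have "down_set (DirIrr L) d \<subseteq> K" using sub by (auto simp: down_set_def)
  then show "d \<in> K" using J_ideal_mem_iff[OF K dc] by simp
qed

lemma J_ideal_eqI:
  assumes "J_ideal L I" "J_ideal L K"
    and "\<And>p. directedly_irreducible L p \<Longrightarrow> p \<in> I \<longleftrightarrow> p \<in> K"
  shows "I = K"
  using assms by (intro subset_antisym J_ideal_subsetI) simp_all

text \<open>
  Compactness closes this set under directed joins, for an arbitrary \<open>Q\<close>. It is the tool for bounding a
  generated \<open>J\<close>-ideal from above.
\<close>

lemma J_ideal_from_irreducibles: "J_ideal L {d \<in> carrier L. down_set (DirIrr L) d \<subseteq> Q}"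
  unfolding J_ideal_iff
proof (intro conjI allI impI)
  show "lower_set L {d \<in> carrier L. down_set (DirIrr L) d \<subseteq> Q}"
    unfolding lower_set_def
  proof (intro conjI ballI impI)
    fix x y assume "x \<in> {d \<in> carrier L. down_set (DirIrr L) d \<subseteq> Q}" "y \<in> carrier L" "y \<sqsubseteq> x"
    moreover from this have "down_set (DirIrr L) y \<subseteq> down_set (DirIrr L) x"
      using le_iff_irreducibles[of y x] by (auto simp: down_set_def)
    ultimately show "y \<in> {d \<in> carrier L. down_set (DirIrr L) d \<subseteq> Q}" by auto
  qed auto
  fix S d assume "S \<subseteq> {d \<in> carrier L. down_set (DirIrr L) d \<subseteq> Q} \<and> directed L S \<and> is_lub L d S"
  then have S: "\<And>s. s \<in> S \<Longrightarrow> down_set (DirIrr L) s \<subseteq> Q" and dir: "directed L S" and lub: "is_lub L d S"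
    by blast+
  have "p \<in> Q" if p: "p \<in> down_set (DirIrr L) d" for p
  proof -
    have irr: "directedly_irreducible L p" "p \<sqsubseteq> d" using p by (simp_all add: down_set_def)
    obtain s where "s \<in> S" "p \<sqsubseteq> s"
      using irreducible_le_directed_lub[OF irr(1) dir lub irr(2)] by blast
    then have "p \<in> down_set (DirIrr L) s" using irr by (simp add: down_set_def)
    then show "p \<in> Q" using S[OF \<open>s \<in> S\<close>] by blast
  qed
  moreover have "d \<in> carrier L" using lub by simp
  ultimately show "d \<in> {d \<in> carrier L. down_set (DirIrr L) d \<subseteq> Q}" by blast
qed

end

lemma DirIrrPFrm_obj_iff: "DirIrrPFrm_obj D \<longleftrightarrow> directedly_generated_preframe D"
  by (auto simp: DirIrrPFrm_obj_def directedly_generated_preframe_def plain_preframe_def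
      directedly_generated_preframe_axioms_def)

section \<open>Arrows of preframes as adjoints on the irreducible elements\<close>

lemma preframe_homD:
  assumes "preframe_hom D D' f"
  shows "f \<in> carrier D \<rightarrow> carrier D'"
    and "directed D S \<Longrightarrow> is_lub D' (f (\<Squnion>\<^bsub>D\<^esub>S)) (f ` S)"
  using assms unfolding preframe_hom_def by blast+

lemma preframe_hom_mono:
  assumes f: "preframe_hom D D' f" and "x \<in> carrier D" "y \<in> carrier D" "x \<sqsubseteq>\<^bsub>D\<^esub> y"
  shows "f x \<sqsubseteq>\<^bsub>D'\<^esub> f y"
proof -
  interpret D: preframe D using f by (simp add: preframe_hom_def)
  interpret D': preframe D' using f by (simp add: preframe_hom_def)
  have "x \<sqinter>\<^bsub>D\<^esub> y = x" using assms D.meet_absorb by simp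
  moreover have "f (x \<sqinter>\<^bsub>D\<^esub> y) = f x \<sqinter>\<^bsub>D'\<^esub> f y" using assms by (simp add: preframe_hom_def)
  moreover have "f x \<in> carrier D'" "f y \<in> carrier D'" using assms by (auto simp: preframe_hom_def)
  ultimately show ?thesis using D'.meet_absorb by metis
qed

lemma directed_image:
  assumes S: "directed D S" and f: "f \<in> carrier D \<rightarrow> carrier D'"
    and mono: "\<And>x y. \<lbrakk>x \<in> carrier D; y \<in> carrier D; x \<sqsubseteq>\<^bsub>D\<^esub> y\<rbrakk> \<Longrightarrow> f x \<sqsubseteq>\<^bsub>D'\<^esub> f y"
  shows "directed D' (f ` S)"
  unfolding directed_def
proof (intro conjI ballI)
  have Sc: "S \<subseteq> carrier D" using S by (simp add: directed_def)
  show "f ` S \<subseteq> carrier D'" using Sc f by blast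
  show "f ` S \<noteq> {}" using S by (simp add: directed_def)
  fix u v assume "u \<in> f ` S" "v \<in> f ` S"
  then obtain x y where xy: "x \<in> S" "y \<in> S" "u = f x" "v = f y" by blast
  then obtain z where z: "z \<in> S" "x \<sqsubseteq>\<^bsub>D\<^esub> z" "y \<sqsubseteq>\<^bsub>D\<^esub> z" using S unfolding directed_def by blast
  show "\<exists>z\<in>f ` S. u \<sqsubseteq>\<^bsub>D'\<^esub> z \<and> v \<sqsubseteq>\<^bsub>D'\<^esub> z"
  proof (rule bexI)
    show "u \<sqsubseteq>\<^bsub>D'\<^esub> f z \<and> v \<sqsubseteq>\<^bsub>D'\<^esub> f z" using xy z Sc by (auto intro!: mono)
  qed (use z in blast)
qed

lemma A_map_closed:
  assumes "directedly_generated_preframe D'" "f \<in> carrier D \<rightarrow> carrier D'"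
  shows "A_map D' f \<in> carrier (Id_J D) \<rightarrow> carrier (Id_J D')"
proof
  interpret D': directedly_generated_preframe D' by fact
  fix I assume "I \<in> carrier (Id_J D)"
  then have "I \<subseteq> carrier D" by (auto dest!: J_ideal_lower_set lower_set_subset)
  then have "f ` I \<subseteq> carrier D'" using assms by blast
  then show "A_map D' f I \<in> carrier (Id_J D')" by (simp add: A_map_def D'.J_ideal_generated)
qed

lemma A_map_upper: "f ` I \<subseteq> A_map D' f I"
  by (auto simp: A_map_def J_ideal_generated_def)

lemma A_map_least: "\<lbrakk>J_ideal D' K; f ` I \<subseteq> K\<rbrakk> \<Longrightarrow> A_map D' f I \<subseteq> K"
  by (auto simp: A_map_def J_ideal_generated_def)

text \<open>
  The elements \<open>y\<close> such that every irreducible element below \<open>y\<close> lies below some \<open>f p\<close> form a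
  \<open>J\<close>-ideal. It contains \<open>f d\<close> for \<open>d \<in> I\<close>, since \<open>f d\<close> is the directed join of the \<open>f p\<close> with \<open>p\<close>
  irreducible below \<open>d\<close>; so it contains the generated ideal.
\<close>

lemma irreducible_mem_A_map:
  assumes D: "directedly_generated_preframe D" and D': "directedly_generated_preframe D'"
    and f: "preframe_hom D D' f" and I: "J_ideal D I" and q: "directedly_irreducible D' q"
  shows "q \<in> A_map D' f I \<longleftrightarrow> (\<exists>p\<in>I. directedly_irreducible D p \<and> q \<sqsubseteq>\<^bsub>D'\<^esub> f p)"
proof
  interpret D: directedly_generated_preframe D by fact
  interpret D': directedly_generated_preframe D' by fact
  have fc: "f \<in> carrier D \<rightarrow> carrier D'" by (rule preframe_homD[OF f])
  have Ic: "I \<subseteq> carrier D" by (rule lower_set_subset[OF J_ideal_lower_set[OF I]])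
  define Q where "Q = {q. \<exists>p\<in>I. directedly_irreducible D p \<and> q \<sqsubseteq>\<^bsub>D'\<^esub> f p}"
  define K where "K = {y \<in> carrier D'. down_set (DirIrr D') y \<subseteq> Q}"
  have "f ` I \<subseteq> K"
  proof
    fix y assume "y \<in> f ` I"
    then obtain d where d: "d \<in> I" "y = f d" by blast
    then have dc: "d \<in> carrier D" using Ic by blast
    let ?S = "down_set (DirIrr D) d"
    have dir: "directed D ?S" by (rule D.irreducibles_below_directed[OF dc])
    have "is_lub D' (f (\<Squnion>\<^bsub>D\<^esub>?S)) (f ` ?S)" by (rule preframe_homD(2)[OF f dir])
    then have lub: "is_lub D' y (f ` ?S)" using d dc by (simp add: D.sup_irreducibles_below)
    have dir': "directed D' (f ` ?S)"
      by (rule directed_image[OF dir fc]) (rule preframe_hom_mono[OF f])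
    have "r \<in> Q" if r: "r \<in> down_set (DirIrr D') y" for r
    proof -
      have "directedly_irreducible D' r" "r \<sqsubseteq>\<^bsub>D'\<^esub> y" using r by (simp_all add: down_set_def)
      then obtain p where p: "p \<in> ?S" "r \<sqsubseteq>\<^bsub>D'\<^esub> f p"
        using D'.irreducible_le_directed_lub[OF _ dir' lub] by blast
      have "?S \<subseteq> I" using D.J_ideal_mem_iff[OF I dc] d by blast
      moreover have "directedly_irreducible D p" using p(1) by (simp add: down_set_def)
      ultimately show "r \<in> Q" unfolding Q_def using p by blast
    qed
    moreover have "y \<in> carrier D'" using d dc fc by blast
    ultimately show "y \<in> K" unfolding K_def by blast
  qed
  then have "A_map D' f I \<subseteq> K"
    unfolding K_def by (rule A_map_least[OF D'.J_ideal_from_irreducibles])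
  moreover assume "q \<in> A_map D' f I"
  moreover have "q \<in> down_set (DirIrr D') q"
    using q D'.irreducible_closed by (simp add: down_set_def)
  ultimately have "q \<in> Q" unfolding K_def by blast
  then show "\<exists>p\<in>I. directedly_irreducible D p \<and> q \<sqsubseteq>\<^bsub>D'\<^esub> f p" by (simp add: Q_def)
next
  interpret D': directedly_generated_preframe D' by fact
  assume "\<exists>p\<in>I. directedly_irreducible D p \<and> q \<sqsubseteq>\<^bsub>D'\<^esub> f p"
  then obtain p where p: "p \<in> I" "q \<sqsubseteq>\<^bsub>D'\<^esub> f p" by blast
  have "f p \<in> A_map D' f I" by (rule subsetD[OF A_map_upper imageI[OF p(1)]])
  moreover have "lower_set D' (A_map D' f I)"
    using A_map_closed[OF D' preframe_homD(1)[OF f]] I by (auto intro: J_ideal_lower_set)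
  ultimately show "q \<in> A_map D' f I"
    using lower_setD D'.irreducible_closed[OF q] p(2) by metis
qed

text \<open>
  A left adjoint of \<open>f\<close> that is defined on irreducible elements only, and takes irreducible values.
  For a preframe homomorphism \<open>f\<close> between directedly generated preframes it exists exactly when
  \<open>A(f)\<close> preserves infima, and is then the map \<open>D(f)\<close>.
\<close>

definition irr_adjoint :: "'a gorder \<Rightarrow> 'b gorder \<Rightarrow> ('a \<Rightarrow> 'b) \<Rightarrow> ('b \<Rightarrow> 'a) \<Rightarrow> bool" where
  "irr_adjoint D D' f g \<longleftrightarrow> g \<in> carrier (DirIrr D') \<rightarrow> carrier (DirIrr D) \<and>
     (\<forall>q\<in>carrier (DirIrr D'). \<forall>d\<in>carrier D. g q \<sqsubseteq>\<^bsub>D\<^esub> d \<longleftrightarrow> q \<sqsubseteq>\<^bsub>D'\<^esub> f d)"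

text \<open>
  Inequalities are tested on irreducible elements \<open>q\<close>, and \<open>q \<sqsubseteq> f x\<close> translates to \<open>g q \<sqsubseteq> x\<close>. Meets
  and the top element are then immediate; for directed joins, \<open>g q\<close> is irreducible and hence compact.
\<close>

lemma irr_adjoint_preframe_hom:
  assumes D: "directedly_generated_preframe D" and D': "directedly_generated_preframe D'"
    and f: "f \<in> carrier D \<rightarrow> carrier D'" and g: "irr_adjoint D D' f g"
  shows "preframe_hom D D' f"
proof -
  interpret D: directedly_generated_preframe D by fact
  interpret D': directedly_generated_preframe D' by fact
  have fc: "f x \<in> carrier D'" if "x \<in> carrier D" for x using f that by blast
  have adj: "g q \<sqsubseteq>\<^bsub>D\<^esub> d \<longleftrightarrow> q \<sqsubseteq>\<^bsub>D'\<^esub> f d" if "directedly_irreducible D' q" "d \<in> carrier D" for q d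
    using g that by (simp add: irr_adjoint_def)
  have gi: "directedly_irreducible D (g q)" if "directedly_irreducible D' q" for q
    using g that by (auto simp: irr_adjoint_def)
  have gc: "g q \<in> carrier D" if "directedly_irreducible D' q" for q
    using gi[OF that] by (rule D.irreducible_closed)
  have mono: "f x \<sqsubseteq>\<^bsub>D'\<^esub> f y" if "x \<in> carrier D" "y \<in> carrier D" "x \<sqsubseteq>\<^bsub>D\<^esub> y" for x y
    unfolding D'.le_iff_irreducibles[OF fc fc, OF that(1,2)]
  proof (intro allI impI)
    fix q assume q: "directedly_irreducible D' q" "q \<sqsubseteq>\<^bsub>D'\<^esub> f x"
    then have "g q \<sqsubseteq>\<^bsub>D\<^esub> x" using adj that(1) by blast
    then have "g q \<sqsubseteq>\<^bsub>D\<^esub> y" by (rule D.le_trans[OF _ that(3) gc[OF q(1)] that(1,2)])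
    then show "q \<sqsubseteq>\<^bsub>D'\<^esub> f y" using adj q(1) that(2) by blast
  qed
  have top: "f \<top>\<^bsub>D\<^esub> = \<top>\<^bsub>D'\<^esub>"
  proof (rule D'.le_antisym)
    show "\<top>\<^bsub>D'\<^esub> \<sqsubseteq>\<^bsub>D'\<^esub> f \<top>\<^bsub>D\<^esub>"
      unfolding D'.le_iff_irreducibles[OF D'.top_closed fc[OF D.top_closed]]
      using adj[OF _ D.top_closed] D.top_higher[OF gc] by simp
    show "f \<top>\<^bsub>D\<^esub> \<sqsubseteq>\<^bsub>D'\<^esub> \<top>\<^bsub>D'\<^esub>" by (rule D'.top_higher[OF fc[OF D.top_closed]])
  qed (rule fc[OF D.top_closed] D'.top_closed)+
  have meet: "f (x \<sqinter>\<^bsub>D\<^esub> y) = f x \<sqinter>\<^bsub>D'\<^esub> f y" if xy: "x \<in> carrier D" "y \<in> carrier D" for x y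
  proof -
    have "x \<sqinter>\<^bsub>D\<^esub> y \<in> carrier D" "f x \<sqinter>\<^bsub>D'\<^esub> f y \<in> carrier D'" using xy fc by auto
    moreover have "q \<sqsubseteq>\<^bsub>D'\<^esub> f (x \<sqinter>\<^bsub>D\<^esub> y) \<longleftrightarrow> q \<sqsubseteq>\<^bsub>D'\<^esub> f x \<sqinter>\<^bsub>D'\<^esub> f y" if "directedly_irreducible D' q" for q
    proof -
      have "q \<sqsubseteq>\<^bsub>D'\<^esub> f (x \<sqinter>\<^bsub>D\<^esub> y) \<longleftrightarrow> g q \<sqsubseteq>\<^bsub>D\<^esub> x \<and> g q \<sqsubseteq>\<^bsub>D\<^esub> y"
        using adj[OF that \<open>x \<sqinter>\<^bsub>D\<^esub> y \<in> carrier D\<close>] D.le_meet_iff[OF xy gc[OF that]] by simp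
      also have "\<dots> \<longleftrightarrow> q \<sqsubseteq>\<^bsub>D'\<^esub> f x \<and> q \<sqsubseteq>\<^bsub>D'\<^esub> f y"
        using adj[OF that xy(1)] adj[OF that xy(2)] by simp
      also have "\<dots> \<longleftrightarrow> q \<sqsubseteq>\<^bsub>D'\<^esub> f x \<sqinter>\<^bsub>D'\<^esub> f y"
        using D'.le_meet_iff[OF fc fc D'.irreducible_closed[OF that], OF xy] by simp
      finally show ?thesis .
    qed
    ultimately show ?thesis
      using D'.le_antisym D'.le_iff_irreducibles fc by meson
  qed
  have sup: "is_lub D' (f (\<Squnion>\<^bsub>D\<^esub>S)) (f ` S)" if S: "directed D S" for S
  proof -
    have lub: "is_lub D (\<Squnion>\<^bsub>D\<^esub>S) S" by (rule D.is_lub_directed_sup[OF S])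
    have Sc: "S \<subseteq> carrier D" using S by (simp add: directed_def)
    have c: "\<Squnion>\<^bsub>D\<^esub>S \<in> carrier D" using lub by simp
    have above: "s \<sqsubseteq>\<^bsub>D\<^esub> \<Squnion>\<^bsub>D\<^esub>S" if "s \<in> S" for s
      using lub that unfolding is_lub_iff[OF Sc] by blast
    have fS: "f ` S \<subseteq> carrier D'" using Sc fc by blast
    show ?thesis
      unfolding is_lub_iff[OF fS]
    proof (intro conjI ballI impI)
      show "f (\<Squnion>\<^bsub>D\<^esub>S) \<in> carrier D'" using fc[OF c] .
      show "y \<sqsubseteq>\<^bsub>D'\<^esub> f (\<Squnion>\<^bsub>D\<^esub>S)" if "y \<in> f ` S" for y
        using that mono[OF _ c above] Sc by blast
      fix u assume u: "u \<in> carrier D'" "\<forall>y\<in>f ` S. y \<sqsubseteq>\<^bsub>D'\<^esub> u"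
      have "q \<sqsubseteq>\<^bsub>D'\<^esub> u" if q: "directedly_irreducible D' q" "q \<sqsubseteq>\<^bsub>D'\<^esub> f (\<Squnion>\<^bsub>D\<^esub>S)" for q
      proof -
        have "g q \<sqsubseteq>\<^bsub>D\<^esub> \<Squnion>\<^bsub>D\<^esub>S" using adj[OF q(1) c] q by simp
        then obtain s where s: "s \<in> S" "g q \<sqsubseteq>\<^bsub>D\<^esub> s"
          using D.irreducible_le_directed_lub[OF gi[OF q(1)] S lub] by blast
        then have "q \<sqsubseteq>\<^bsub>D'\<^esub> f s" using adj[OF q(1)] Sc by blast
        moreover have "f s \<sqsubseteq>\<^bsub>D'\<^esub> u" "f s \<in> carrier D'" using s(1) u(2) fS by blast+
        ultimately show ?thesis
          by (rule D'.le_trans[OF _ _ D'.irreducible_closed[OF q(1)] _ u(1)])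
      qed
      then show "f (\<Squnion>\<^bsub>D\<^esub>S) \<sqsubseteq>\<^bsub>D'\<^esub> u" unfolding D'.le_iff_irreducibles[OF fc[OF c] u(1)] by blast
    qed
  qed
  show ?thesis
    unfolding preframe_hom_def
    using f top meet sup D.preframe_axioms D'.preframe_axioms by blast
qed

lemma irr_adjoint_inf_pres:
  assumes D: "directedly_generated_preframe D" and D': "directedly_generated_preframe D'"
    and f: "f \<in> carrier D \<rightarrow> carrier D'" and g: "irr_adjoint D D' f g"
  shows "inf_pres (Id_J D) (Id_J D') (A_map D' f)"
  unfolding inf_pres_def
proof (intro conjI allI impI)
  interpret D: directedly_generated_preframe D by fact
  interpret D': directedly_generated_preframe D' by fact
  have hom: "preframe_hom D D' f" using irr_adjoint_preframe_hom[OF assms] .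
  show "complete_lattice (Id_J D)" by (rule D.complete_lattice_Id_J)
  show "complete_lattice (Id_J D')" by (rule D'.complete_lattice_Id_J)
  have gi: "directedly_irreducible D (g q)" if "directedly_irreducible D' q" for q
    using g that by (auto simp: irr_adjoint_def)
  \<comment> \<open>On irreducible elements \<open>A(f)\<close> is the preimage under \<open>g\<close>, which commutes with intersections.\<close>
  have mem: "q \<in> A_map D' f I \<longleftrightarrow> g q \<in> I" if I: "J_ideal D I" and q: "directedly_irreducible D' q" for I q
  proof -
    have gq: "g q \<in> carrier D" by (rule D.irreducible_closed[OF gi[OF q]])
    have adj: "g q \<sqsubseteq>\<^bsub>D\<^esub> d \<longleftrightarrow> q \<sqsubseteq>\<^bsub>D'\<^esub> f d" if "d \<in> carrier D" for d
      using g q that by (simp add: irr_adjoint_def)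
    show ?thesis
      unfolding irreducible_mem_A_map[OF D D' hom I q]
    proof
      assume "\<exists>p\<in>I. directedly_irreducible D p \<and> q \<sqsubseteq>\<^bsub>D'\<^esub> f p"
      then obtain p where p: "p \<in> I" "directedly_irreducible D p" "q \<sqsubseteq>\<^bsub>D'\<^esub> f p" by blast
      then have "g q \<sqsubseteq>\<^bsub>D\<^esub> p" using adj[OF D.irreducible_closed] by blast
      then show "g q \<in> I" by (rule lower_setD[OF J_ideal_lower_set[OF I] p(1) gq])
    next
      assume "g q \<in> I"
      then show "\<exists>p\<in>I. directedly_irreducible D p \<and> q \<sqsubseteq>\<^bsub>D'\<^esub> f p"
        using gi[OF q] adj[OF gq] D.le_refl[OF gq] by blast
    qed
  qed
  fix \<A> assume \<A>: "\<A> \<subseteq> carrier (Id_J D)"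
  then have \<A>': "A_map D' f ` \<A> \<subseteq> carrier (Id_J D')" using A_map_closed[OF D' f] by blast
  have J: "J_ideal D (carrier D \<inter> \<Inter>\<A>)" using \<A> by (intro D.J_ideal_Inter) auto
  have J': "J_ideal D' (carrier D' \<inter> \<Inter>(A_map D' f ` \<A>))"
    using \<A>' by (intro D'.J_ideal_Inter) auto
  have JA: "J_ideal D' (A_map D' f (carrier D \<inter> \<Inter>\<A>))"
    using A_map_closed[OF D' f] J by auto
  have "q \<in> A_map D' f (carrier D \<inter> \<Inter>\<A>) \<longleftrightarrow> q \<in> carrier D' \<inter> \<Inter>(A_map D' f ` \<A>)"
    if q: "directedly_irreducible D' q" for q
    unfolding mem[OF J q]
    using \<A> mem[OF _ q] gi[OF q] D.irreducible_closed D'.irreducible_closed[OF q] by auto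
  then have "A_map D' f (carrier D \<inter> \<Inter>\<A>) = carrier D' \<inter> \<Inter>(A_map D' f ` \<A>)"
    by (rule D'.J_ideal_eqI[OF JA J'])
  then show "A_map D' f (\<Sqinter>\<^bsub>Id_J D\<^esub>\<A>) = \<Sqinter>\<^bsub>Id_J D'\<^esub>(A_map D' f ` \<A>)"
    by (simp add: D.inf_Id_J[OF \<A>] D'.inf_Id_J[OF \<A>'])
qed

lemma DirIrrPFrm_arrD:
  assumes "DirIrrPFrm_arr f"
  shows "directedly_generated_preframe (src f)" "directedly_generated_preframe (tgt f)"
    "app f \<in> extensional (carrier (src f))" "preframe_hom (src f) (tgt f) (app f)"
    "app f \<in> carrier (src f) \<rightarrow> carrier (tgt f)"
    "inf_pres (Id_J (src f)) (Id_J (tgt f)) (A_map (tgt f) (app f))"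
  using assms preframe_homD(1)[of "src f" "tgt f" "app f"]
  unfolding DirIrrPFrm_arr_def DirIrrPFrm_obj_iff by blast+

lemma DirIrrPFrm_arrI:
  assumes "directedly_generated_preframe (src f)" "directedly_generated_preframe (tgt f)"
    and "app f \<in> extensional (carrier (src f))" "app f \<in> carrier (src f) \<rightarrow> carrier (tgt f)"
    and "irr_adjoint (src f) (tgt f) (app f) g"
  shows "DirIrrPFrm_arr f"
  unfolding DirIrrPFrm_arr_def DirIrrPFrm_obj_iff
  using assms irr_adjoint_preframe_hom[OF assms(1,2,4,5)] irr_adjoint_inf_pres[OF assms(1,2,4,5)]
  by blast

lemma A_left_adjoint_is_left_adjoint:
  assumes "DirIrrPFrm_arr f"
  shows "is_left_adjoint (Id_J (src f)) (Id_J (tgt f)) (A_map (tgt f) (app f)) (A_left_adjoint f)"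
  unfolding A_left_adjoint_def
  by (rule inf_pres_left_adjoint[OF A_map_closed]) (rule DirIrrPFrm_arrD[OF assms])+

lemma irreducible_mem_A_map_down_set:
  assumes D: "directedly_generated_preframe D" and D': "directedly_generated_preframe D'"
    and f: "preframe_hom D D' f" and d: "d \<in> carrier D" and q: "directedly_irreducible D' q"
  shows "q \<in> A_map D' f (down_set D d) \<longleftrightarrow> q \<sqsubseteq>\<^bsub>D'\<^esub> f d"
proof -
  interpret D: directedly_generated_preframe D by fact
  interpret D': directedly_generated_preframe D' by fact
  note fc = preframe_homD(1)[OF f] and qc = D'.irreducible_closed[OF q]
  have J: "J_ideal D (down_set D d)" by (rule D.J_ideal_down_set[OF d])
  show ?thesis
  proof
    assume "q \<in> A_map D' f (down_set D d)"
    then obtain p where p: "p \<in> down_set D d" "q \<sqsubseteq>\<^bsub>D'\<^esub> f p"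
      unfolding irreducible_mem_A_map[OF D D' f J q] by blast
    then have pc: "p \<in> carrier D" "p \<sqsubseteq>\<^bsub>D\<^esub> d" by (simp_all add: down_set_def)
    have "f p \<sqsubseteq>\<^bsub>D'\<^esub> f d" by (rule preframe_hom_mono[OF f pc(1) d pc(2)])
    moreover have "f p \<in> carrier D'" "f d \<in> carrier D'" using fc pc d by blast+
    ultimately show "q \<sqsubseteq>\<^bsub>D'\<^esub> f d" using D'.le_trans[OF p(2) _ qc] by simp
  next
    assume q: "q \<sqsubseteq>\<^bsub>D'\<^esub> f d"
    have "d \<in> down_set D d" using d by (simp add: down_set_def)
    then have "f d \<in> A_map D' f (down_set D d)" by (rule subsetD[OF A_map_upper imageI])
    moreover have "J_ideal D' (A_map D' f (down_set D d))" using A_map_closed[OF D' fc] J by auto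
    ultimately show "q \<in> A_map D' f (down_set D d)"
      using lower_setD[OF J_ideal_lower_set _ qc q] by blast
  qed
qed

text \<open>
  Let \<open>M\<close> be the value of the left adjoint at the principal ideal of \<open>q\<close>. The unit puts \<open>q\<close> into
  \<open>A(f)(M)\<close>, so \<open>q \<sqsubseteq> f p\<close> for some irreducible \<open>p \<in> M\<close>. Then \<open>q\<close> already lies in \<open>A(f)\<close> of the
  principal ideal of \<open>p\<close>, and adjointness bounds \<open>M\<close> by this ideal.
\<close>

lemma A_left_adjoint_principal:
  assumes f: "DirIrrPFrm_arr f" and q: "directedly_irreducible (tgt f) q"
  shows "\<exists>p. directedly_irreducible (src f) p \<and>
    A_left_adjoint f (down_set (tgt f) q) = down_set (src f) p"
proof -
  note D = DirIrrPFrm_arrD[OF f] and adj = A_left_adjoint_is_left_adjoint[OF f]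
  interpret D: directedly_generated_preframe "src f" by (rule D)
  interpret D': directedly_generated_preframe "tgt f" by (rule D)
  have qc: "q \<in> carrier (tgt f)" by (rule D'.irreducible_closed[OF q])
  have Jq: "J_ideal (tgt f) (down_set (tgt f) q)" by (rule D'.J_ideal_down_set[OF qc])
  have qq: "q \<in> down_set (tgt f) q" using qc by (simp add: down_set_def)
  define M where "M = A_left_adjoint f (down_set (tgt f) q)"
  have M: "J_ideal (src f) M" using adj Jq unfolding is_left_adjoint_iff M_def by auto
  have gal: "M \<subseteq> I \<longleftrightarrow> down_set (tgt f) q \<subseteq> A_map (tgt f) (app f) I" if "J_ideal (src f) I" for I
    using adj Jq that unfolding is_left_adjoint_iff M_def by simp
  have "q \<in> A_map (tgt f) (app f) M" using gal[OF M] qq by blast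
  then obtain p where p: "p \<in> M" "directedly_irreducible (src f) p" "q \<sqsubseteq>\<^bsub>tgt f\<^esub> app f p"
    unfolding irreducible_mem_A_map[OF D(1,2,4) M q] by blast
  have pc: "p \<in> carrier (src f)" by (rule D.irreducible_closed[OF p(2)])
  have Jp: "J_ideal (src f) (down_set (src f) p)" by (rule D.J_ideal_down_set[OF pc])
  have "J_ideal (tgt f) (A_map (tgt f) (app f) (down_set (src f) p))"
    using A_map_closed[OF D(2,5)] Jp by auto
  moreover have "q \<in> A_map (tgt f) (app f) (down_set (src f) p)"
    unfolding irreducible_mem_A_map_down_set[OF D(1,2,4) pc q] by (rule p)
  ultimately have "down_set (tgt f) q \<subseteq> A_map (tgt f) (app f) (down_set (src f) p)"
    by (auto simp: down_set_def dest!: J_ideal_lower_set intro: lower_setD)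
  then have "M \<subseteq> down_set (src f) p" using gal[OF Jp] by simp
  moreover have "down_set (src f) p \<subseteq> M"
    using lower_setD[OF J_ideal_lower_set[OF M] p(1)] by (auto simp: down_set_def)
  ultimately show ?thesis using p(2) unfolding M_def by blast
qed

lemma (in plain_preframe) down_set_subset_iff:
  "\<lbrakk>x \<in> carrier L; y \<in> carrier L\<rbrakk> \<Longrightarrow> down_set L x \<subseteq> down_set L y \<longleftrightarrow> x \<sqsubseteq> y"
  unfolding down_set_def using le_trans[of _ x y] le_refl[of x] by blast

lemma D_arr_principal:
  assumes f: "DirIrrPFrm_arr f" and q: "directedly_irreducible (tgt f) q"
  shows "directedly_irreducible (src f) (app (D_arr f) q)"
    and "A_left_adjoint f (down_set (tgt f) q) = down_set (src f) (app (D_arr f) q)"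
proof -
  interpret D: directedly_generated_preframe "src f" by (rule DirIrrPFrm_arrD[OF f])
  let ?P = "\<lambda>d. d \<in> carrier (DirIrr (src f)) \<and>
    A_left_adjoint f (down_set (tgt f) q) = down_set (src f) d"
  obtain p where p: "?P p" using A_left_adjoint_principal[OF f q] by auto
  have "?P (THE d. ?P d)"
  proof (rule theI[of ?P p])
    show "?P p" by (rule p)
    fix d assume d: "?P d"
    then have "down_set (src f) d = down_set (src f) p" using p by simp
    moreover have "d \<in> carrier (src f)" "p \<in> carrier (src f)"
      using d p D.irreducible_closed by simp_all
    ultimately show "d = p" using D.le_antisym D.down_set_subset_iff by (metis order_refl)
  qed
  moreover have "app (D_arr f) q = (THE d. ?P d)" using q by (simp add: D_arr_def)
  ultimately show "directedly_irreducible (src f) (app (D_arr f) q)"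
    and "A_left_adjoint f (down_set (tgt f) q) = down_set (src f) (app (D_arr f) q)"
    by simp_all
qed

text \<open>
  The adjunction between \<open>A(f)\<close> and its left adjoint, read on the principal ideals of \<open>q\<close> and \<open>d\<close>.
\<close>

lemma D_arr_irr_adjoint:
  assumes f: "DirIrrPFrm_arr f"
  shows "irr_adjoint (src f) (tgt f) (app f) (app (D_arr f))"
  unfolding irr_adjoint_def
proof (intro conjI ballI)
  note D = DirIrrPFrm_arrD[OF f] and adj = A_left_adjoint_is_left_adjoint[OF f]
  interpret D: directedly_generated_preframe "src f" by (rule D)
  interpret D': directedly_generated_preframe "tgt f" by (rule D)
  show "app (D_arr f) \<in> carrier (DirIrr (tgt f)) \<rightarrow> carrier (DirIrr (src f))"
    using D_arr_principal(1)[OF f] by simp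
  fix q d assume "q \<in> carrier (DirIrr (tgt f))" and d: "d \<in> carrier (src f)"
  then have q: "directedly_irreducible (tgt f) q" by simp
  have qc: "q \<in> carrier (tgt f)" by (rule D'.irreducible_closed[OF q])
  have gc: "app (D_arr f) q \<in> carrier (src f)"
    by (rule D.irreducible_closed[OF D_arr_principal(1)[OF f q]])
  have J: "J_ideal (tgt f) (A_map (tgt f) (app f) (down_set (src f) d))"
    using A_map_closed[OF D(2,5)] D.J_ideal_down_set[OF d] by auto
  have "app (D_arr f) q \<sqsubseteq>\<^bsub>src f\<^esub> d \<longleftrightarrow> A_left_adjoint f (down_set (tgt f) q) \<subseteq> down_set (src f) d"
    using D.down_set_subset_iff[OF gc d] D_arr_principal(2)[OF f q] by simp
  also have "\<dots> \<longleftrightarrow> down_set (tgt f) q \<subseteq> A_map (tgt f) (app f) (down_set (src f) d)"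
    using adj D.J_ideal_down_set[OF d] D'.J_ideal_down_set[OF qc] by (simp add: is_left_adjoint_iff)
  also have "\<dots> \<longleftrightarrow> q \<in> A_map (tgt f) (app f) (down_set (src f) d)"
  proof
    show "q \<in> A_map (tgt f) (app f) (down_set (src f) d)"
      if "down_set (tgt f) q \<subseteq> A_map (tgt f) (app f) (down_set (src f) d)"
      using that qc D'.le_refl[OF qc] unfolding down_set_def by blast
    show "down_set (tgt f) q \<subseteq> A_map (tgt f) (app f) (down_set (src f) d)"
      if "q \<in> A_map (tgt f) (app f) (down_set (src f) d)"
      using lower_setD[OF J_ideal_lower_set[OF J] that] by (auto simp: down_set_def)
  qed
  also have "\<dots> \<longleftrightarrow> q \<sqsubseteq>\<^bsub>tgt f\<^esub> app f d"
    by (rule irreducible_mem_A_map_down_set[OF D(1,2,4) d q])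
  finally show "app (D_arr f) q \<sqsubseteq>\<^bsub>src f\<^esub> d \<longleftrightarrow> q \<sqsubseteq>\<^bsub>tgt f\<^esub> app f d" .
qed

lemma src_D_arr [simp]: "src (D_arr f) = DirIrr (tgt f)"
  and tgt_D_arr [simp]: "tgt (D_arr f) = DirIrr (src f)"
  by (simp_all add: D_arr_def)

text \<open>
  Uniqueness of adjoints, the means of computing \<open>D(f)\<close> without its defining description.
\<close>

lemma D_arr_eqI:
  assumes f: "DirIrrPFrm_arr f" and g: "irr_adjoint (src f) (tgt f) (app f) g"
  shows "D_arr f = \<lparr>src = DirIrr (tgt f), tgt = DirIrr (src f), app = restrict g (carrier (DirIrr (tgt f)))\<rparr>"
proof -
  interpret D: directedly_generated_preframe "src f" by (rule DirIrrPFrm_arrD[OF f])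
  have "app (D_arr f) = restrict g (carrier (DirIrr (tgt f)))"
  proof (rule extensionalityI)
    show "app (D_arr f) \<in> extensional (carrier (DirIrr (tgt f)))" by (simp add: D_arr_def)
    fix q assume q: "q \<in> carrier (DirIrr (tgt f))"
    have h: "irr_adjoint (src f) (tgt f) (app f) (app (D_arr f))" by (rule D_arr_irr_adjoint[OF f])
    have c: "app (D_arr f) q \<in> carrier (src f)" "g q \<in> carrier (src f)"
      using q funcset_mem[of _ "carrier (DirIrr (tgt f))" "carrier (DirIrr (src f))" q] g h
        D.irreducible_closed
      unfolding irr_adjoint_def by simp_all
    have "app (D_arr f) q \<sqsubseteq>\<^bsub>src f\<^esub> d \<longleftrightarrow> g q \<sqsubseteq>\<^bsub>src f\<^esub> d" if "d \<in> carrier (src f)" for d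
      using q g h that unfolding irr_adjoint_def by simp
    from this[OF c(1)] this[OF c(2)] D.le_refl[OF c(1)] D.le_refl[OF c(2)]
    have "app (D_arr f) q = g q" using D.le_antisym[OF _ _ c] by simp
    then show "app (D_arr f) q = restrict g (carrier (DirIrr (tgt f))) q" using q by simp
  qed simp
  then show ?thesis by simp
qed

section \<open>The two categories\<close>

lemma src_arrow_id [simp]: "src (arrow_id P) = P"
  and tgt_arrow_id [simp]: "tgt (arrow_id P) = P"
  and app_arrow_id [simp]: "app (arrow_id P) = (\<lambda>x\<in>carrier P. x)"
  by (simp_all add: arrow_id_def)

lemma src_arrow_comp [simp]: "src (arrow_comp g f) = src f"
  and tgt_arrow_comp [simp]: "tgt (arrow_comp g f) = tgt g"
  and app_arrow_comp [simp]: "app (arrow_comp g f) = compose (carrier (src f)) (app g) (app f)"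
  by (simp_all add: arrow_comp_def)

lemma arrow_comp_id_right:
  assumes "app f \<in> extensional (carrier (src f))" "app f \<in> carrier (src f) \<rightarrow> carrier (tgt f)"
  shows "arrow_comp f (arrow_id (src f)) = f"
  using compose_Id[OF assms(2,1)] by (simp add: arrow_comp_def)

lemma arrow_comp_id_left:
  assumes "app f \<in> extensional (carrier (src f))" "app f \<in> carrier (src f) \<rightarrow> carrier (tgt f)"
  shows "arrow_comp (arrow_id (tgt f)) f = f"
  using Id_compose[OF assms(2,1)] by (simp add: arrow_comp_def)

lemma arrow_comp_assoc:
  assumes "app f \<in> carrier (src f) \<rightarrow> carrier (tgt f)" "tgt f = src g"
  shows "arrow_comp h (arrow_comp g f) = arrow_comp (arrow_comp h g) f"
  using compose_assoc[of "app f" "carrier (src f)" "carrier (src g)" "app h" "app g"] assms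
  by (simp add: arrow_comp_def)

lemma irr_adjoint_id: "irr_adjoint D D (\<lambda>x\<in>carrier D. x) (\<lambda>q. q)"
  by (simp add: irr_adjoint_def)

lemma irr_adjoint_comp:
  assumes "irr_adjoint D D' f g" "irr_adjoint D' D'' f' g'" "f \<in> carrier D \<rightarrow> carrier D'"
  shows "irr_adjoint D D'' (compose (carrier D) f' f) (\<lambda>q. g (g' q))"
  using assms by (auto simp: irr_adjoint_def compose_eq Pi_iff)

lemma DirIrrPFrm_arr_id: "directedly_generated_preframe D \<Longrightarrow> DirIrrPFrm_arr (arrow_id D)"
  by (rule DirIrrPFrm_arrI[where g = "\<lambda>q. q"]) (simp_all add: irr_adjoint_id)

lemma DirIrrPFrm_arr_comp:
  assumes f: "DirIrrPFrm_arr f" and g: "DirIrrPFrm_arr g" and eq: "tgt f = src g"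
  shows "DirIrrPFrm_arr (arrow_comp g f)"
    and "irr_adjoint (src f) (tgt g) (app (arrow_comp g f)) (\<lambda>q. app (D_arr f) (app (D_arr g) q))"
proof -
  note F = DirIrrPFrm_arrD[OF f] and G = DirIrrPFrm_arrD[OF g]
  show adj: "irr_adjoint (src f) (tgt g) (app (arrow_comp g f)) (\<lambda>q. app (D_arr f) (app (D_arr g) q))"
    using irr_adjoint_comp[OF D_arr_irr_adjoint[OF f] _ F(5)] D_arr_irr_adjoint[OF g] eq by simp
  have "app (arrow_comp g f) \<in> carrier (src f) \<rightarrow> carrier (tgt g)"
    using F(5) G(5) eq by (auto simp: compose_eq Pi_iff)
  then show "DirIrrPFrm_arr (arrow_comp g f)"
    using adj F(1) G(2) by (intro DirIrrPFrm_arrI) simp_all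
qed

lemma category_DirIrrPFrm: "category DirIrrPFrm"
proof (rule category.intro, goal_cases)
  case (11 f g h)
  then show ?case
    by (simp add: DirIrrPFrm_def arrow_comp_assoc[OF DirIrrPFrm_arrD(5)])
qed (simp_all add: DirIrrPFrm_def DirIrrPFrm_obj_iff DirIrrPFrm_arrD DirIrrPFrm_arr_id
  DirIrrPFrm_arr_comp arrow_comp_id_left arrow_comp_id_right)

lemma inf_Id_low:
  assumes "F \<subseteq> carrier (Id_low P)"
  shows "\<Sqinter>\<^bsub>Id_low P\<^esub>F = carrier P \<inter> \<Inter>F"
proof (rule partial_order.inf_eqI)
  show "partial_order (Id_low P)" by (simp add: Id_low_def partial_order_inclusion_order)
  show "is_glb (Id_low P) (carrier P \<inter> \<Inter>F) F"
    unfolding is_glb_iff[OF assms]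
    using assms by (auto simp: Id_low_def lower_set_def)
qed

text \<open>
  Finite meets reduce to the empty and the binary one. The empty meet is the carrier, which is a lower
  set anyway, so the condition on it is directedness.
\<close>

lemma Pos_dir_obj_iff:
  "Pos_dir_obj P \<longleftrightarrow> partial_order P \<and> directed P (carrier P) \<and>
     (\<forall>I\<in>carrier (Id_dir P). \<forall>J\<in>carrier (Id_dir P). I \<inter> J \<in> carrier (Id_dir P))"
proof -
  have inf: "\<Sqinter>\<^bsub>Id_low P\<^esub>F = carrier P \<inter> \<Inter>F" if "F \<subseteq> carrier (Id_dir P)" for F
    using that by (intro inf_Id_low) auto
  have fin: "(\<forall>F. finite F \<and> F \<subseteq> carrier (Id_dir P) \<longrightarrow> \<Sqinter>\<^bsub>Id_low P\<^esub>F \<in> carrier (Id_dir P)) \<longleftrightarrow>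
    (\<forall>F. finite F \<and> F \<subseteq> carrier (Id_dir P) \<longrightarrow> carrier P \<inter> \<Inter>F \<in> carrier (Id_dir P))"
    using inf by metis
  show ?thesis
    unfolding Pos_dir_obj_def fin
  proof (rule conj_cong[OF refl], intro iffI conjI ballI allI impI)
    assume *: "\<forall>F. finite F \<and> F \<subseteq> carrier (Id_dir P) \<longrightarrow> carrier P \<inter> \<Inter>F \<in> carrier (Id_dir P)"
    show "directed P (carrier P)" using *[rule_format, of "{}"] by simp
    fix I J assume IJ: "I \<in> carrier (Id_dir P)" "J \<in> carrier (Id_dir P)"
    then have "I \<subseteq> carrier P" by (simp add: lower_set_subset)
    then have "I \<inter> J = carrier P \<inter> \<Inter>{I, J}" by auto
    then show "I \<inter> J \<in> carrier (Id_dir P)" using *[rule_format, of "{I, J}"] IJ by simp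
  next
    fix F assume *: "directed P (carrier P) \<and>
      (\<forall>I\<in>carrier (Id_dir P). \<forall>J\<in>carrier (Id_dir P). I \<inter> J \<in> carrier (Id_dir P))"
      and "finite F \<and> F \<subseteq> carrier (Id_dir P)"
    then have "finite F" "F \<subseteq> carrier (Id_dir P)" by auto
    then show "carrier P \<inter> \<Inter>F \<in> carrier (Id_dir P)"
    proof induction
      case empty
      have "lower_set P (carrier P)" by (simp add: lower_set_def)
      then show ?case using conjunct1[OF *] by simp
    next
      case (insert I F)
      then have "I \<in> carrier (Id_dir P)" "carrier P \<inter> \<Inter>F \<in> carrier (Id_dir P)" by simp_all
      then have "I \<inter> (carrier P \<inter> \<Inter>F) \<in> carrier (Id_dir P)" using conjunct2[OF *] by blast
      moreover have "carrier P \<inter> \<Inter>(insert I F) = I \<inter> (carrier P \<inter> \<Inter>F)" by auto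
      ultimately show ?case by simp
    qed
  qed
qed

lemma Pos_dir_arrD:
  assumes "Pos_dir_arr g"
  shows "Pos_dir_obj (src g)" "Pos_dir_obj (tgt g)"
    "app g \<in> extensional (carrier (src g))" "app g \<in> carrier (src g) \<rightarrow> carrier (tgt g)"
    "\<lbrakk>x \<in> carrier (src g); y \<in> carrier (src g); x \<sqsubseteq>\<^bsub>src g\<^esub> y\<rbrakk> \<Longrightarrow> app g x \<sqsubseteq>\<^bsub>tgt g\<^esub> app g y"
    "inverse_image (src g) (app g) \<in> carrier (Id_dir (tgt g)) \<rightarrow> carrier (Id_dir (src g))"
  using assms unfolding Pos_dir_arr_def isotone_def by blast+

lemma Pos_dir_arrI:
  assumes "Pos_dir_obj (src g)" "Pos_dir_obj (tgt g)"
    and "app g \<in> extensional (carrier (src g))" "app g \<in> carrier (src g) \<rightarrow> carrier (tgt g)"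
    and "\<And>x y. \<lbrakk>x \<in> carrier (src g); y \<in> carrier (src g); x \<sqsubseteq>\<^bsub>src g\<^esub> y\<rbrakk> \<Longrightarrow> app g x \<sqsubseteq>\<^bsub>tgt g\<^esub> app g y"
    and "inverse_image (src g) (app g) \<in> carrier (Id_dir (tgt g)) \<rightarrow> carrier (Id_dir (src g))"
  shows "Pos_dir_arr g"
  using assms unfolding Pos_dir_arr_def isotone_def Pos_dir_obj_iff partial_order_def by blast

lemma inverse_image_id: "I \<subseteq> carrier P \<Longrightarrow> inverse_image P (\<lambda>x\<in>carrier P. x) I = I"
  by (auto simp: inverse_image_def)

lemma inverse_image_compose:
  "f \<in> carrier P \<rightarrow> carrier Q \<Longrightarrow>
   inverse_image P (compose (carrier P) g f) I = inverse_image P f (inverse_image Q g I)"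
  by (auto simp: inverse_image_def compose_eq)

lemma Pos_dir_arr_id: "Pos_dir_obj P \<Longrightarrow> Pos_dir_arr (arrow_id P)"
  by (rule Pos_dir_arrI) (simp_all add: inverse_image_id lower_set_subset)

lemma Pos_dir_arr_comp:
  assumes f: "Pos_dir_arr f" and g: "Pos_dir_arr g" and eq: "tgt f = src g"
  shows "Pos_dir_arr (arrow_comp g f)"
proof (rule Pos_dir_arrI)
  note F = Pos_dir_arrD[OF f, unfolded eq] and G = Pos_dir_arrD[OF g]
  show "Pos_dir_obj (src (arrow_comp g f))" "Pos_dir_obj (tgt (arrow_comp g f))"
    using F(1) G(2) by simp_all
  show "app (arrow_comp g f) \<in> extensional (carrier (src (arrow_comp g f)))" by simp
  show "app (arrow_comp g f) \<in> carrier (src (arrow_comp g f)) \<rightarrow> carrier (tgt (arrow_comp g f))"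
    using F(4) G(4) by (auto simp: compose_eq Pi_iff)
  show "app (arrow_comp g f) x \<sqsubseteq>\<^bsub>tgt (arrow_comp g f)\<^esub> app (arrow_comp g f) y"
    if "x \<in> carrier (src (arrow_comp g f))" "y \<in> carrier (src (arrow_comp g f))"
      "x \<sqsubseteq>\<^bsub>src (arrow_comp g f)\<^esub> y" for x y
  proof -
    have xy: "x \<in> carrier (src f)" "y \<in> carrier (src f)" "x \<sqsubseteq>\<^bsub>src f\<^esub> y" using that by simp_all
    then have "app f x \<in> carrier (src g)" "app f y \<in> carrier (src g)" using F(4) by blast+
    from G(5)[OF this F(5)[OF xy]] show ?thesis using xy by (simp add: compose_eq)
  qed
  show "inverse_image (src (arrow_comp g f)) (app (arrow_comp g f))
    \<in> carrier (Id_dir (tgt (arrow_comp g f))) \<rightarrow> carrier (Id_dir (src (arrow_comp g f)))"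
    unfolding src_arrow_comp tgt_arrow_comp app_arrow_comp
    using F(6) G(6) by (simp only: inverse_image_compose[OF F(4)] Pi_iff) blast
qed

lemma category_Pos_dir: "category Pos_dir"
proof (rule category.intro, goal_cases)
  case (11 f g h)
  then show ?case
    by (simp add: Pos_dir_def arrow_comp_assoc[OF Pos_dir_arrD(4)])
qed (simp_all add: Pos_dir_def Pos_dir_arrD(1-4) Pos_dir_arr_id Pos_dir_arr_comp
  arrow_comp_id_left arrow_comp_id_right)

section \<open>The functor of directedly irreducible elements\<close>

text \<open>
  The irreducible elements below \<open>\<top>\<close> are all of them, and those below \<open>x \<sqinter> y\<close> are those below both \<open>x\<close>
  and \<open>y\<close>.
\<close>

lemma (in directedly_generated_preframe) Pos_dir_obj_DirIrr: "Pos_dir_obj (DirIrr L)"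
  unfolding Pos_dir_obj_iff
proof (intro conjI ballI)
  show "partial_order (DirIrr L)" by (rule partial_order_DirIrr)
  have "down_set (DirIrr L) \<top> = carrier (DirIrr L)"
    using top_higher irreducible_closed by (auto simp: down_set_def)
  then show "directed (DirIrr L) (carrier (DirIrr L))"
    using irreducibles_below_Id_dir[OF top_closed] by simp
  fix I J assume I: "I \<in> carrier (Id_dir (DirIrr L))" and J: "J \<in> carrier (Id_dir (DirIrr L))"
  have "directed L I" "directed L J" using I J directed_DirIrr by simp_all
  then have c: "\<Squnion>I \<in> carrier L" "\<Squnion>J \<in> carrier L"
    using is_lub_directed_sup by (auto intro: least_closed)
  have "down_set (DirIrr L) (\<Squnion>I) \<inter> down_set (DirIrr L) (\<Squnion>J) = down_set (DirIrr L) (\<Squnion>I \<sqinter> \<Squnion>J)"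
    using le_meet_iff[OF c irreducible_closed] by (auto simp: down_set_def)
  then have "I \<inter> J = down_set (DirIrr L) (\<Squnion>I \<sqinter> \<Squnion>J)"
    by (simp only: irreducibles_below_sup[OF I] irreducibles_below_sup[OF J])
  also have "\<dots> \<in> carrier (Id_dir (DirIrr L))"
    by (rule irreducibles_below_Id_dir) (use c in simp)
  finally show "I \<inter> J \<in> carrier (Id_dir (DirIrr L))" .
qed

text \<open>
  The adjunction of \<open>irr_adjoint\<close> as an equation of sets. As every directed lower set of irreducible
  elements has the form displayed on the left, it makes \<open>D(f)\<close> an arrow; it is also the naturality of
  the isomorphism of \<open>D\<close> with \<open>Id_dir (DirIrr D)\<close>.
\<close>

lemma inverse_image_D_arr:
  assumes f: "DirIrrPFrm_arr f" and d: "d \<in> carrier (src f)"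
  shows "inverse_image (DirIrr (tgt f)) (app (D_arr f)) (down_set (DirIrr (src f)) d) =
    down_set (DirIrr (tgt f)) (app f d)"
  using D_arr_irr_adjoint[OF f] d
  by (auto simp: inverse_image_def down_set_def irr_adjoint_def Pi_iff)

lemma Pos_dir_arr_D_arr:
  assumes f: "DirIrrPFrm_arr f"
  shows "Pos_dir_arr (D_arr f)"
proof (rule Pos_dir_arrI)
  note D = DirIrrPFrm_arrD[OF f]
  interpret D: directedly_generated_preframe "src f" by (rule D)
  interpret D': directedly_generated_preframe "tgt f" by (rule D)
  show "Pos_dir_obj (src (D_arr f))" using D'.Pos_dir_obj_DirIrr by simp
  show "Pos_dir_obj (tgt (D_arr f))" using D.Pos_dir_obj_DirIrr by simp
  show "app (D_arr f) \<in> extensional (carrier (src (D_arr f)))" by (simp add: D_arr_def)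
  have g: "app (D_arr f) q \<in> carrier (src f)" if "directedly_irreducible (tgt f) q" for q
    by (rule D.irreducible_closed[OF D_arr_principal(1)[OF f that]])
  show "app (D_arr f) \<in> carrier (src (D_arr f)) \<rightarrow> carrier (tgt (D_arr f))"
    using D_arr_principal(1)[OF f] by simp
  have adj: "app (D_arr f) q \<sqsubseteq>\<^bsub>src f\<^esub> d \<longleftrightarrow> q \<sqsubseteq>\<^bsub>tgt f\<^esub> app f d"
    if "directedly_irreducible (tgt f) q" "d \<in> carrier (src f)" for q d
    using D_arr_irr_adjoint[OF f] that by (simp add: irr_adjoint_def)
  show "app (D_arr f) q \<sqsubseteq>\<^bsub>tgt (D_arr f)\<^esub> app (D_arr f) r"
    if "q \<in> carrier (src (D_arr f))" "r \<in> carrier (src (D_arr f))" "q \<sqsubseteq>\<^bsub>src (D_arr f)\<^esub> r" for q r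
  proof -
    have q: "directedly_irreducible (tgt f) q" and r: "directedly_irreducible (tgt f) r"
      and qr: "q \<sqsubseteq>\<^bsub>tgt f\<^esub> r"
      using that by simp_all
    have "r \<sqsubseteq>\<^bsub>tgt f\<^esub> app f (app (D_arr f) r)" using adj[OF r g[OF r]] D.le_refl[OF g[OF r]] by simp
    then have "q \<sqsubseteq>\<^bsub>tgt f\<^esub> app f (app (D_arr f) r)"
      by (rule D'.le_trans[OF qr]) (use q r D'.irreducible_closed g[OF r] D(5) in blast)+
    then show ?thesis using adj[OF q g[OF r]] by simp
  qed
  show "inverse_image (src (D_arr f)) (app (D_arr f))
    \<in> carrier (Id_dir (tgt (D_arr f))) \<rightarrow> carrier (Id_dir (src (D_arr f)))"
  proof
    fix I assume "I \<in> carrier (Id_dir (tgt (D_arr f)))"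
    then have I: "I \<in> carrier (Id_dir (DirIrr (src f)))" by simp
    then have "directed (src f) I" using D.directed_DirIrr by simp
    then have c: "\<Squnion>\<^bsub>src f\<^esub>I \<in> carrier (src f)" by (rule least_closed[OF D.is_lub_directed_sup])
    have "inverse_image (DirIrr (tgt f)) (app (D_arr f)) I =
        down_set (DirIrr (tgt f)) (app f (\<Squnion>\<^bsub>src f\<^esub>I))"
      using inverse_image_D_arr[OF f c] by (simp only: D.irreducibles_below_sup[OF I])
    also have "\<dots> \<in> carrier (Id_dir (DirIrr (tgt f)))"
      by (rule D'.irreducibles_below_Id_dir) (use c D(5) in blast)
    finally show "inverse_image (src (D_arr f)) (app (D_arr f)) I \<in> carrier (Id_dir (src (D_arr f)))"
      by simp
  qed
qed

lemma D_arr_id: "directedly_generated_preframe D \<Longrightarrow> D_arr (arrow_id D) = arrow_id (DirIrr D)"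
  using D_arr_eqI[OF DirIrrPFrm_arr_id, of D "\<lambda>q. q"] irr_adjoint_id[of D] by (simp add: arrow_id_def)

lemma D_arr_comp:
  assumes f: "DirIrrPFrm_arr f" and g: "DirIrrPFrm_arr g" and eq: "tgt f = src g"
  shows "D_arr (arrow_comp g f) = arrow_comp (D_arr f) (D_arr g)"
  using D_arr_eqI[OF DirIrrPFrm_arr_comp(1)[OF f g eq], of "\<lambda>q. app (D_arr f) (app (D_arr g) q)"]
    DirIrrPFrm_arr_comp(2)[OF f g eq]
  by (simp add: arrow_comp_def compose_def)

lemma category_op_cat: "category C \<Longrightarrow> category (op_cat C)"
  by (simp add: category_def op_cat_def)

lemma D_functor: "cat_functor (op_cat DirIrrPFrm) Pos_dir D_obj D_arr"
proof (rule cat_functor.intro)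
  show "category (op_cat DirIrrPFrm)" by (rule category_op_cat[OF category_DirIrrPFrm])
  show "category Pos_dir" by (rule category_Pos_dir)
  show "cat_functor_axioms (op_cat DirIrrPFrm) Pos_dir D_obj D_arr"
    by (rule cat_functor_axioms.intro)
      (simp_all add: op_cat_def DirIrrPFrm_def Pos_dir_def D_obj_def DirIrrPFrm_obj_iff D_arr_id
        D_arr_comp Pos_dir_arr_D_arr directedly_generated_preframe.Pos_dir_obj_DirIrr)
qed

section \<open>The functor of directed lower sets\<close>

lemma Id_dir_directed_Union:
  assumes S: "directed (Id_dir P) \<S>"
  shows "\<Union>\<S> \<in> carrier (Id_dir P)" and "is_lub (Id_dir P) (\<Union>\<S>) \<S>"
proof -
  have Sc: "\<S> \<subseteq> carrier (Id_dir P)" and ne: "\<S> \<noteq> {}"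
    and dir: "\<And>I J. \<lbrakk>I \<in> \<S>; J \<in> \<S>\<rbrakk> \<Longrightarrow> \<exists>K\<in>\<S>. I \<subseteq> K \<and> J \<subseteq> K"
    using S by (simp_all add: directed_def)
  have low: "lower_set P I" and di: "directed P I" if "I \<in> \<S>" for I
    using Sc that by auto
  have "lower_set P (\<Union>\<S>)"
    unfolding lower_set_def using lower_set_subset[OF low] lower_setD[OF low] by blast
  moreover have "directed P (\<Union>\<S>)"
    unfolding directed_def
  proof (intro conjI ballI)
    show "\<Union>\<S> \<subseteq> carrier P" using lower_set_subset[OF low] by blast
    show "\<Union>\<S> \<noteq> {}" using ne di unfolding directed_def by blast
    fix x y assume "x \<in> \<Union>\<S>" "y \<in> \<Union>\<S>"
    then obtain I J where "I \<in> \<S>" "x \<in> I" "J \<in> \<S>" "y \<in> J" by blast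
    with dir obtain K where K: "K \<in> \<S>" "x \<in> K" "y \<in> K" by blast
    then obtain z where "z \<in> K" "x \<sqsubseteq>\<^bsub>P\<^esub> z" "y \<sqsubseteq>\<^bsub>P\<^esub> z" using di unfolding directed_def by blast
    then show "\<exists>z\<in>\<Union>\<S>. x \<sqsubseteq>\<^bsub>P\<^esub> z \<and> y \<sqsubseteq>\<^bsub>P\<^esub> z" using K by blast
  qed
  ultimately show U: "\<Union>\<S> \<in> carrier (Id_dir P)" by simp
  show "is_lub (Id_dir P) (\<Union>\<S>) \<S>"
    unfolding is_lub_iff[OF Sc] using U by auto
qed

lemma partial_order_Id_dir: "partial_order (Id_dir P)"
  by (simp add: Id_dir_def partial_order_inclusion_order)

lemma sup_Id_dir: "directed (Id_dir P) \<S> \<Longrightarrow> \<Squnion>\<^bsub>Id_dir P\<^esub>\<S> = \<Union>\<S>"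
  by (rule partial_order.sup_eqI[OF partial_order_Id_dir Id_dir_directed_Union(2)])

lemma is_lub_Id_dir_directed_iff:
  "directed (Id_dir P) \<S> \<Longrightarrow> is_lub (Id_dir P) I \<S> \<longleftrightarrow> I = \<Union>\<S>"
  using Id_dir_directed_Union(2) partial_order.least_unique[OF partial_order_Id_dir] by metis

locale Pos_dir_poset = partial_order L for L :: "'a gorder" (structure) +
  assumes carrier_directed: "directed L (carrier L)"
    and Int_Id_dir: "\<lbrakk>I \<in> carrier (Id_dir L); J \<in> carrier (Id_dir L)\<rbrakk> \<Longrightarrow> I \<inter> J \<in> carrier (Id_dir L)"
begin

lemma is_glb_Id_dir:
  assumes "I \<in> carrier (Id_dir L)" "J \<in> carrier (Id_dir L)"
  shows "is_glb (Id_dir L) (I \<inter> J) {I, J}"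
proof -
  have "{I, J} \<subseteq> carrier (Id_dir L)" using assms by blast
  from is_glb_iff[OF this] show ?thesis using Int_Id_dir[OF assms] by auto
qed

lemma meet_Id_dir:
  "\<lbrakk>I \<in> carrier (Id_dir L); J \<in> carrier (Id_dir L)\<rbrakk> \<Longrightarrow> I \<sqinter>\<^bsub>Id_dir L\<^esub> J = I \<inter> J"
  unfolding meet_def by (rule partial_order.inf_eqI[OF partial_order_Id_dir is_glb_Id_dir])

text \<open>
  Meets are intersections and directed joins are unions, so distributivity is that of sets.
\<close>

lemma preframe_Id_dir: "preframe (Id_dir L)"
proof (intro preframe.intro preframe_axioms.intro lower_semilattice.intro
    lower_semilattice_axioms.intro weak_partial_order_top.intro weak_partial_order_top_axioms.intro)
  show po: "partial_order (Id_dir L)" by (rule partial_order_Id_dir)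
  then show "weak_partial_order (Id_dir L)" by (rule partial_order.axioms)
  show "\<exists>s. is_glb (Id_dir L) s {I, J}" if "I \<in> carrier (Id_dir L)" "J \<in> carrier (Id_dir L)" for I J
    using is_glb_Id_dir[OF that] by blast
  have "lower_set L (carrier L)" by (simp add: lower_set_def)
  then have "greatest (Id_dir L) (carrier L) (carrier (Id_dir L))"
    using carrier_directed lower_set_subset by (auto simp: greatest_def)
  then show "\<exists>x. greatest (Id_dir L) x (carrier (Id_dir L))" by blast
  fix \<S> assume S: "directed (Id_dir L) \<S>"
  show "\<exists>s. is_lub (Id_dir L) s \<S>" using Id_dir_directed_Union(2)[OF S] by blast
  fix I assume I: "I \<in> carrier (Id_dir L)"
  have Sc: "\<S> \<subseteq> carrier (Id_dir L)" using S by (simp add: directed_def)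
  have img: "(\<lambda>J. I \<sqinter>\<^bsub>Id_dir L\<^esub> J) ` \<S> = (\<lambda>J. I \<inter> J) ` \<S>"
    using meet_Id_dir[OF I] Sc by (intro image_cong) auto
  have "directed (Id_dir L) ((\<lambda>J. I \<inter> J) ` \<S>)"
    by (rule directed_image[OF S]) (use Int_Id_dir[OF I] in auto)
  then have "\<Squnion>\<^bsub>Id_dir L\<^esub>((\<lambda>J. I \<inter> J) ` \<S>) = I \<inter> \<Union>\<S>" by (simp add: sup_Id_dir)
  then show "I \<sqinter>\<^bsub>Id_dir L\<^esub> (\<Squnion>\<^bsub>Id_dir L\<^esub>\<S>) = \<Squnion>\<^bsub>Id_dir L\<^esub>((\<lambda>J. I \<sqinter>\<^bsub>Id_dir L\<^esub> J) ` \<S>)"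
    unfolding img sup_Id_dir[OF S] meet_Id_dir[OF I Id_dir_directed_Union(1)[OF S]] by simp
qed

lemma mem_down_set_self: "p \<in> carrier L \<Longrightarrow> p \<in> down_set L p"
  by (simp add: down_set_def)

lemma down_set_subset_lower_set_iff:
  assumes "lower_set L I" "p \<in> carrier L"
  shows "down_set L p \<subseteq> I \<longleftrightarrow> p \<in> I"
  using mem_down_set_self[OF assms(2)] lower_setD[OF assms(1)] by (auto simp: down_set_def)

lemma down_set_Id_dir: "p \<in> carrier L \<Longrightarrow> down_set L p \<in> carrier (Id_dir L)"
proof -
  assume p: "p \<in> carrier L"
  have "lower_set L (down_set L p)"
    unfolding lower_set_def down_set_def using le_trans[OF _ _ _ _ p] by simp
  moreover have "directed L (down_set L p)"
    unfolding directed_def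
  proof (intro conjI ballI)
    show "down_set L p \<subseteq> carrier L" by (auto simp: down_set_def)
    show "down_set L p \<noteq> {}" using mem_down_set_self[OF p] by blast
    show "\<exists>z\<in>down_set L p. x \<sqsubseteq> z \<and> y \<sqsubseteq> z" if "x \<in> down_set L p" "y \<in> down_set L p" for x y
      using that mem_down_set_self[OF p] by (intro bexI[of _ p]) (simp_all add: down_set_def)
  qed
  ultimately show "down_set L p \<in> carrier (Id_dir L)" by simp
qed

lemma down_set_le_iff:
  assumes "p \<in> carrier L" "q \<in> carrier L"
  shows "down_set L p \<subseteq> down_set L q \<longleftrightarrow> p \<sqsubseteq> q"
  using down_set_subset_lower_set_iff[of "down_set L q" p] down_set_Id_dir[OF assms(2)] assms(1)
  by (simp add: down_set_def)

lemma directed_principal_ideals: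
  assumes I: "I \<in> carrier (Id_dir L)"
  shows "directed (Id_dir L) (down_set L ` I)" and "\<Union>(down_set L ` I) = I"
proof -
  have Ic: "I \<subseteq> carrier L" and low: "lower_set L I" and dir: "directed L I"
    using I by (simp_all add: lower_set_subset)
  show "directed (Id_dir L) (down_set L ` I)"
    by (rule directed_image[OF dir]) (simp_all add: down_set_Id_dir[simplified] down_set_le_iff)
  show "\<Union>(down_set L ` I) = I"
  proof
    show "\<Union>(down_set L ` I) \<subseteq> I" using down_set_subset_lower_set_iff[OF low] Ic by blast
    show "I \<subseteq> \<Union>(down_set L ` I)" using mem_down_set_self Ic by blast
  qed
qed

text \<open>
  An irreducible \<open>I\<close> is a member of the directed family of its principal subideals. Conversely, if the
  principal ideal of \<open>p\<close> is a directed union, some member contains \<open>p\<close> and is therefore all of it.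
\<close>

lemma irreducible_Id_dir_iff:
  "directedly_irreducible (Id_dir L) I \<longleftrightarrow> (\<exists>p\<in>carrier L. I = down_set L p)"
proof
  assume irr: "directedly_irreducible (Id_dir L) I"
  then have I: "I \<in> carrier (Id_dir L)" unfolding directedly_irreducible_def by blast
  have "I \<in> down_set L ` I"
    using irr directed_principal_ideals[OF I] is_lub_Id_dir_directed_iff[OF directed_principal_ideals(1)[OF I]]
    unfolding directedly_irreducible_def by simp
  moreover have "I \<subseteq> carrier L" using I by (simp add: lower_set_subset)
  ultimately show "\<exists>p\<in>carrier L. I = down_set L p" by blast
next
  assume "\<exists>p\<in>carrier L. I = down_set L p"
  then obtain p where p: "p \<in> carrier L" and I: "I = down_set L p" by blast
  show "directedly_irreducible (Id_dir L) I"
    unfolding directedly_irreducible_def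
  proof (intro conjI allI impI)
    show "I \<in> carrier (Id_dir L)" using down_set_Id_dir[OF p] I by simp
    fix \<S> assume S: "directed (Id_dir L) \<S> \<and> is_lub (Id_dir L) I \<S>"
    then have eq: "I = \<Union>\<S>" using is_lub_Id_dir_directed_iff by blast
    then obtain J where J: "J \<in> \<S>" "p \<in> J" using mem_down_set_self[OF p] I by blast
    have "lower_set L J" using S J by (auto simp: directed_def)
    then have "I \<subseteq> J" using down_set_subset_lower_set_iff[OF _ p] J I by simp
    then have "J = I" using eq J by blast
    then show "I \<in> \<S>" using J by simp
  qed
qed

lemma directedly_generated_Id_dir: "directedly_generated_preframe (Id_dir L)"
proof (intro directedly_generated_preframe.intro plain_preframe.intro preframe_Id_dir
    directedly_generated_preframe_axioms.intro)
  show "directedly_generated (Id_dir L)"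
    unfolding directedly_generated_def
  proof
    fix I assume I: "I \<in> carrier (Id_dir L)"
    note dir = directed_principal_ideals[OF I]
    have "down_set L ` I \<subseteq> carrier (DirIrr (Id_dir L))"
      using I lower_set_subset[of L I] by (auto simp: irreducible_Id_dir_iff)
    moreover have "is_lub (Id_dir L) I (down_set L ` I)"
      using is_lub_Id_dir_directed_iff[OF dir(1)] dir(2) by simp
    ultimately show "\<exists>S. S \<subseteq> carrier (DirIrr (Id_dir L)) \<and> directed (Id_dir L) S \<and> is_lub (Id_dir L) I S"
      using dir(1) by blast
  qed
qed

end

lemma Pos_dir_obj_poset: "Pos_dir_obj P \<longleftrightarrow> Pos_dir_poset P"
  unfolding Pos_dir_obj_iff Pos_dir_poset_def Pos_dir_poset_axioms_def by blast

lemma src_E_arr [simp]: "src (E_arr g) = Id_dir (tgt g)"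
  and tgt_E_arr [simp]: "tgt (E_arr g) = Id_dir (src g)"
  and app_E_arr [simp]: "app (E_arr g) = (\<lambda>I\<in>carrier (Id_dir (tgt g)). inverse_image (src g) (app g) I)"
  by (simp_all add: E_arr_def)

text \<open>
  On principal ideals this is \<open>\<down>p \<mapsto> \<down>(g p)\<close>, written without choosing a generator of the ideal.
\<close>

definition lower_image :: "'b gorder \<Rightarrow> ('a \<Rightarrow> 'b) \<Rightarrow> 'a set \<Rightarrow> 'b set" where
  "lower_image Q g I = {y \<in> carrier Q. \<exists>x\<in>I. y \<sqsubseteq>\<^bsub>Q\<^esub> g x}"

lemma lower_image_down_set:
  assumes g: "Pos_dir_arr g" and p: "p \<in> carrier (src g)"
  shows "lower_image (tgt g) (app g) (down_set (src g) p) = down_set (tgt g) (app g p)"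
proof -
  note G = Pos_dir_arrD[OF g]
  interpret P: Pos_dir_poset "src g" using G(1) by (simp add: Pos_dir_obj_poset)
  interpret Q: Pos_dir_poset "tgt g" using G(2) by (simp add: Pos_dir_obj_poset)
  have gp: "app g p \<in> carrier (tgt g)" using G(4) p by blast
  show ?thesis
  proof
    show "lower_image (tgt g) (app g) (down_set (src g) p) \<subseteq> down_set (tgt g) (app g p)"
    proof
      fix y assume "y \<in> lower_image (tgt g) (app g) (down_set (src g) p)"
      then obtain x where y: "y \<in> carrier (tgt g)" "y \<sqsubseteq>\<^bsub>tgt g\<^esub> app g x"
        and x: "x \<in> carrier (src g)" "x \<sqsubseteq>\<^bsub>src g\<^esub> p"
        unfolding lower_image_def down_set_def by blast
      have "app g x \<in> carrier (tgt g)" using G(4) x by blast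
      from Q.le_trans[OF y(2) G(5)[OF x(1) p x(2)] y(1) this gp]
      show "y \<in> down_set (tgt g) (app g p)" using y by (simp add: down_set_def)
    qed
    show "down_set (tgt g) (app g p) \<subseteq> lower_image (tgt g) (app g) (down_set (src g) p)"
      using P.mem_down_set_self[OF p] unfolding lower_image_def down_set_def by blast
  qed
qed

text \<open>
  At the principal ideal of \<open>p\<close>, both sides of the adjunction say that \<open>g p \<in> I\<close>.
\<close>

lemma E_arr_irr_adjoint:
  assumes g: "Pos_dir_arr g"
  shows "irr_adjoint (Id_dir (tgt g)) (Id_dir (src g)) (app (E_arr g)) (lower_image (tgt g) (app g))"
proof -
  note G = Pos_dir_arrD[OF g]
  interpret P: Pos_dir_poset "src g" using G(1) by (simp add: Pos_dir_obj_poset)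
  interpret Q: Pos_dir_poset "tgt g" using G(2) by (simp add: Pos_dir_obj_poset)
  show ?thesis
    unfolding irr_adjoint_def
  proof (intro conjI ballI)
    show "lower_image (tgt g) (app g)
      \<in> carrier (DirIrr (Id_dir (src g))) \<rightarrow> carrier (DirIrr (Id_dir (tgt g)))"
    proof
      fix K assume "K \<in> carrier (DirIrr (Id_dir (src g)))"
      then obtain p where p: "p \<in> carrier (src g)" "K = down_set (src g) p"
        by (auto simp: P.irreducible_Id_dir_iff)
      then show "lower_image (tgt g) (app g) K \<in> carrier (DirIrr (Id_dir (tgt g)))"
        using lower_image_down_set[OF g p(1)] G(4) by (auto simp: Q.irreducible_Id_dir_iff)
    qed
    fix K I assume "K \<in> carrier (DirIrr (Id_dir (src g)))" and I: "I \<in> carrier (Id_dir (tgt g))"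
    then obtain p where p: "p \<in> carrier (src g)" and K: "K = down_set (src g) p"
      by (auto simp: P.irreducible_Id_dir_iff)
    have gp: "app g p \<in> carrier (tgt g)" using G(4) p by blast
    have inv: "inverse_image (src g) (app g) I \<in> carrier (Id_dir (src g))" using G(6) I by blast
    have "lower_image (tgt g) (app g) K \<subseteq> I \<longleftrightarrow> app g p \<in> I"
      unfolding K lower_image_down_set[OF g p]
      by (rule Q.down_set_subset_lower_set_iff) (use I gp in simp_all)
    also have "\<dots> \<longleftrightarrow> p \<in> inverse_image (src g) (app g) I" using p by (simp add: inverse_image_def)
    also have "\<dots> \<longleftrightarrow> K \<subseteq> inverse_image (src g) (app g) I"
      unfolding K by (rule P.down_set_subset_lower_set_iff[symmetric]) (use inv p in simp_all)
    finally show "lower_image (tgt g) (app g) K \<sqsubseteq>\<^bsub>Id_dir (tgt g)\<^esub> I \<longleftrightarrow>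
        K \<sqsubseteq>\<^bsub>Id_dir (src g)\<^esub> app (E_arr g) I"
      using I by simp
  qed
qed

lemma DirIrrPFrm_arr_E_arr:
  assumes g: "Pos_dir_arr g"
  shows "DirIrrPFrm_arr (E_arr g)"
proof (rule DirIrrPFrm_arrI)
  note G = Pos_dir_arrD[OF g]
  show "directedly_generated_preframe (src (E_arr g))" "directedly_generated_preframe (tgt (E_arr g))"
    using G(1,2) Pos_dir_poset.directedly_generated_Id_dir by (simp_all add: Pos_dir_obj_poset)
  show "app (E_arr g) \<in> extensional (carrier (src (E_arr g)))" by (simp only: app_E_arr src_E_arr restrict_extensional)
  show "app (E_arr g) \<in> carrier (src (E_arr g)) \<rightarrow> carrier (tgt (E_arr g))"
    unfolding app_E_arr src_E_arr tgt_E_arr using G(6) by (simp only: restrict_Pi_cancel)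
  show "irr_adjoint (src (E_arr g)) (tgt (E_arr g)) (app (E_arr g)) (lower_image (tgt g) (app g))"
    unfolding src_E_arr tgt_E_arr by (rule E_arr_irr_adjoint[OF g])
qed

lemma E_arr_id: "E_arr (arrow_id P) = arrow_id (Id_dir P)"
  by (simp add: E_arr_def arrow_id_def inverse_image_id lower_set_subset cong: restrict_cong)

lemma E_arr_comp:
  assumes f: "Pos_dir_arr f" and g: "Pos_dir_arr g" and eq: "tgt f = src g"
  shows "E_arr (arrow_comp g f) = arrow_comp (E_arr f) (E_arr g)"
proof -
  note F = Pos_dir_arrD[OF f, unfolded eq] and G = Pos_dir_arrD[OF g]
  have "(\<lambda>I\<in>carrier (Id_dir (tgt g)). inverse_image (src f) (compose (carrier (src f)) (app g) (app f)) I) =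
    compose (carrier (Id_dir (tgt g))) (app (E_arr f)) (app (E_arr g))"
    unfolding compose_def[of "carrier (Id_dir (tgt g))"]
  proof (rule restrict_ext)
    fix I assume I: "I \<in> carrier (Id_dir (tgt g))"
    then have "inverse_image (src g) (app g) I \<in> carrier (Id_dir (src g))" using G(6) by blast
    then show "inverse_image (src f) (compose (carrier (src f)) (app g) (app f)) I =
        app (E_arr f) (app (E_arr g) I)"
      using I eq by (simp add: inverse_image_compose[OF F(4)])
  qed
  then show ?thesis by (simp add: arrow_comp_def E_arr_def)
qed

lemma E_functor: "cat_functor Pos_dir (op_cat DirIrrPFrm) E_obj E_arr"
proof (rule cat_functor.intro)
  show "category (op_cat DirIrrPFrm)" by (rule category_op_cat[OF category_DirIrrPFrm])
  show "category Pos_dir" by (rule category_Pos_dir)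
  show "cat_functor_axioms Pos_dir (op_cat DirIrrPFrm) E_obj E_arr"
    by (rule cat_functor_axioms.intro)
      (simp_all add: op_cat_def DirIrrPFrm_def Pos_dir_def E_obj_def DirIrrPFrm_obj_iff E_arr_id
        E_arr_comp DirIrrPFrm_arr_E_arr Pos_dir_obj_poset Pos_dir_poset.directedly_generated_Id_dir
        del: app_E_arr)
qed

section \<open>Order isomorphisms\<close>

text \<open>
  An order isomorphism preserves irreducible elements, and its inverse is its left adjoint. So it is an
  isomorphism in \<open>DirIrrPFrm\<close> or in \<open>Pos_dir\<close> as soon as both orders are objects there; for the
  components of the two natural isomorphisms only the bijection has to be checked.
\<close>

locale order_isomorphism =
  fixes A :: "'a gorder" and B :: "'b gorder" and \<phi> :: "'a \<Rightarrow> 'b" and \<psi> :: "'b \<Rightarrow> 'a"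
  assumes \<phi>_closed: "\<phi> \<in> carrier A \<rightarrow> carrier B" and \<psi>_closed: "\<psi> \<in> carrier B \<rightarrow> carrier A"
    and \<psi>_\<phi>: "x \<in> carrier A \<Longrightarrow> \<psi> (\<phi> x) = x" and \<phi>_\<psi>: "y \<in> carrier B \<Longrightarrow> \<phi> (\<psi> y) = y"
    and le_iff: "\<lbrakk>x \<in> carrier A; x' \<in> carrier A\<rbrakk> \<Longrightarrow> \<phi> x \<sqsubseteq>\<^bsub>B\<^esub> \<phi> x' \<longleftrightarrow> x \<sqsubseteq>\<^bsub>A\<^esub> x'"
begin

lemma \<phi>_mem: "x \<in> carrier A \<Longrightarrow> \<phi> x \<in> carrier B" and \<psi>_mem: "y \<in> carrier B \<Longrightarrow> \<psi> y \<in> carrier A"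
  using \<phi>_closed \<psi>_closed by blast+

lemma flip: "order_isomorphism B A \<psi> \<phi>"
proof
  fix y y' assume y: "y \<in> carrier B" "y' \<in> carrier B"
  show "\<psi> y \<sqsubseteq>\<^bsub>A\<^esub> \<psi> y' \<longleftrightarrow> y \<sqsubseteq>\<^bsub>B\<^esub> y'"
    using le_iff[OF \<psi>_mem[OF y(1)] \<psi>_mem[OF y(2)]] by (simp add: y \<phi>_\<psi>)
qed (use \<phi>_closed \<psi>_closed \<psi>_\<phi> \<phi>_\<psi> in simp_all)

lemma adjoint: "\<lbrakk>x \<in> carrier A; y \<in> carrier B\<rbrakk> \<Longrightarrow> \<psi> y \<sqsubseteq>\<^bsub>A\<^esub> x \<longleftrightarrow> y \<sqsubseteq>\<^bsub>B\<^esub> \<phi> x"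
  using le_iff[OF \<psi>_mem[of y], of x] by (simp add: \<phi>_\<psi>)

lemma directed_\<phi>: "directed A S \<Longrightarrow> directed B (\<phi> ` S)"
  by (erule directed_image) (simp_all add: \<phi>_closed le_iff)

lemma is_lub_\<phi>:
  assumes S: "S \<subseteq> carrier A" and d: "is_lub A d S"
  shows "is_lub B (\<phi> d) (\<phi> ` S)"
proof -
  have d': "d \<in> carrier A" "\<And>s. s \<in> S \<Longrightarrow> s \<sqsubseteq>\<^bsub>A\<^esub> d"
    "\<And>u. \<lbrakk>u \<in> carrier A; \<forall>s\<in>S. s \<sqsubseteq>\<^bsub>A\<^esub> u\<rbrakk> \<Longrightarrow> d \<sqsubseteq>\<^bsub>A\<^esub> u"
    using d unfolding is_lub_iff[OF S] by blast+
  have \<phi>S: "\<phi> ` S \<subseteq> carrier B" using S \<phi>_closed by blast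
  show ?thesis
    unfolding is_lub_iff[OF \<phi>S]
  proof (intro conjI ballI impI)
    show "\<phi> d \<in> carrier B" by (rule \<phi>_mem[OF d'(1)])
    show "y \<sqsubseteq>\<^bsub>B\<^esub> \<phi> d" if "y \<in> \<phi> ` S" for y using that S d'(1,2) le_iff by blast
    interpret inv: order_isomorphism B A \<psi> \<phi> by (rule flip)
    fix u assume u: "u \<in> carrier B" "\<forall>y\<in>\<phi> ` S. y \<sqsubseteq>\<^bsub>B\<^esub> u"
    then have "\<forall>s\<in>S. s \<sqsubseteq>\<^bsub>A\<^esub> \<psi> u" using inv.adjoint[OF u(1)] S by blast
    then have "d \<sqsubseteq>\<^bsub>A\<^esub> \<psi> u" by (rule d'(3)[OF \<psi>_mem[OF u(1)]])
    then show "\<phi> d \<sqsubseteq>\<^bsub>B\<^esub> u" using inv.adjoint[OF u(1) d'(1)] by simp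
  qed
qed

lemma irreducible_\<phi>:
  assumes p: "directedly_irreducible A p"
  shows "directedly_irreducible B (\<phi> p)"
  unfolding directedly_irreducible_def
proof (intro conjI allI impI)
  interpret inv: order_isomorphism B A \<psi> \<phi> by (rule flip)
  have pc: "p \<in> carrier A" using p unfolding directedly_irreducible_def by blast
  then show "\<phi> p \<in> carrier B" by (rule \<phi>_mem)
  fix S assume "directed B S \<and> is_lub B (\<phi> p) S"
  then have S: "directed B S" "is_lub B (\<phi> p) S" and Sc: "S \<subseteq> carrier B"
    unfolding directed_def by blast+
  have "is_lub A p (\<psi> ` S)" using inv.is_lub_\<phi>[OF Sc S(2)] by (simp add: \<psi>_\<phi>[OF pc])
  then have "p \<in> \<psi> ` S"
    using p inv.directed_\<phi>[OF S(1)] unfolding directedly_irreducible_def by blast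
  then obtain s where s: "s \<in> S" "p = \<psi> s" by blast
  then have "s \<in> carrier B" using Sc by blast
  then show "\<phi> p \<in> S" using s by (simp add: \<phi>_\<psi>)
qed

definition iso_arrow :: "('a, 'b) arrow" where
  "iso_arrow = \<lparr>src = A, tgt = B, app = restrict \<phi> (carrier A)\<rparr>"

lemma DirIrrPFrm_arr_iso_arrow:
  assumes "directedly_generated_preframe A" "directedly_generated_preframe B"
  shows "DirIrrPFrm_arr iso_arrow"
proof (rule DirIrrPFrm_arrI)
  interpret inv: order_isomorphism B A \<psi> \<phi> by (rule flip)
  interpret B: directedly_generated_preframe B by fact
  show "irr_adjoint (src iso_arrow) (tgt iso_arrow) (app iso_arrow) \<psi>"
    using inv.irreducible_\<phi> adjoint B.irreducible_closed by (simp add: iso_arrow_def irr_adjoint_def)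
qed (use assms \<phi>_closed in \<open>simp_all add: iso_arrow_def restrict_Pi_cancel\<close>)

lemma Pos_dir_arr_iso_arrow:
  assumes "Pos_dir_obj A" "Pos_dir_obj B"
  shows "Pos_dir_arr iso_arrow"
proof (rule Pos_dir_arrI)
  interpret inv: order_isomorphism B A \<psi> \<phi> by (rule flip)
  show "inverse_image (src iso_arrow) (app iso_arrow)
    \<in> carrier (Id_dir (tgt iso_arrow)) \<rightarrow> carrier (Id_dir (src iso_arrow))"
  proof
    fix I assume "I \<in> carrier (Id_dir (tgt iso_arrow))"
    then have low: "lower_set B I" and dir: "directed B I" by (simp_all add: iso_arrow_def)
    have Ic: "I \<subseteq> carrier B" by (rule lower_set_subset[OF low])
    have eq: "inverse_image (src iso_arrow) (app iso_arrow) I = {x \<in> carrier A. \<phi> x \<in> I}"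
      by (auto simp: iso_arrow_def inverse_image_def)
    have eq': "{x \<in> carrier A. \<phi> x \<in> I} = \<psi> ` I"
    proof
      show "{x \<in> carrier A. \<phi> x \<in> I} \<subseteq> \<psi> ` I" using \<psi>_\<phi> by force
      show "\<psi> ` I \<subseteq> {x \<in> carrier A. \<phi> x \<in> I}" using Ic \<psi>_mem \<phi>_\<psi> by auto
    qed
    have "lower_set A {x \<in> carrier A. \<phi> x \<in> I}"
      unfolding lower_set_def
    proof (intro conjI ballI impI)
      fix x y assume xy: "x \<in> {x \<in> carrier A. \<phi> x \<in> I}" "y \<in> carrier A" "y \<sqsubseteq>\<^bsub>A\<^esub> x"
      then have "\<phi> x \<in> I" "\<phi> y \<sqsubseteq>\<^bsub>B\<^esub> \<phi> x" using le_iff by simp_all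
      from lower_setD[OF low this(1) \<phi>_mem[OF xy(2)] this(2)] xy(2)
      show "y \<in> {x \<in> carrier A. \<phi> x \<in> I}" by simp
    qed blast
    then show "inverse_image (src iso_arrow) (app iso_arrow) I \<in> carrier (Id_dir (src iso_arrow))"
      using inv.directed_\<phi>[OF dir] unfolding eq eq' by (simp add: iso_arrow_def)
  qed
qed (use assms \<phi>_closed le_iff in \<open>simp_all add: iso_arrow_def restrict_Pi_cancel\<close>)

end

lemma (in order_isomorphism) inverse_iso_arrows:
  "inverse_arrows iso_arrow (order_isomorphism.iso_arrow B A \<psi>)"
proof -
  interpret inv: order_isomorphism B A \<psi> \<phi> by (rule flip)
  have "compose (carrier A) (restrict \<psi> (carrier B)) (restrict \<phi> (carrier A)) = (\<lambda>x\<in>carrier A. x)"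
    unfolding compose_def by (rule restrict_ext) (simp add: \<phi>_mem \<psi>_\<phi>)
  moreover have "compose (carrier B) (restrict \<phi> (carrier A)) (restrict \<psi> (carrier B)) = (\<lambda>y\<in>carrier B. y)"
    unfolding compose_def by (rule restrict_ext) (simp add: \<psi>_mem \<phi>_\<psi>)
  ultimately show ?thesis
    by (simp add: inverse_arrows_def iso_arrow_def inv.iso_arrow_def arrow_comp_def arrow_id_def)
qed

lemma (in order_isomorphism) DirIrrPFrm_iso_iso_arrow:
  assumes "directedly_generated_preframe A" "directedly_generated_preframe B"
  shows "DirIrrPFrm_iso iso_arrow"
  unfolding DirIrrPFrm_iso_def
  using DirIrrPFrm_arr_iso_arrow[OF assms] inverse_iso_arrows
    order_isomorphism.DirIrrPFrm_arr_iso_arrow[OF flip assms(2,1)] by blast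

lemma (in order_isomorphism) Pos_dir_iso_iso_arrow:
  assumes "Pos_dir_obj A" "Pos_dir_obj B"
  shows "Pos_dir_iso iso_arrow"
  unfolding Pos_dir_iso_def
  using Pos_dir_arr_iso_arrow[OF assms] inverse_iso_arrows
    order_isomorphism.Pos_dir_arr_iso_arrow[OF flip assms(2,1)] by blast

section \<open>The duality\<close>

definition eta :: "'a gorder \<Rightarrow> ('a, 'a set) arrow" where
  "eta D = \<lparr>src = D, tgt = Id_dir (DirIrr D), app = (\<lambda>d\<in>carrier D. down_set (DirIrr D) d)\<rparr>"

definition eps :: "'a gorder \<Rightarrow> ('a, 'a set) arrow" where
  "eps P = \<lparr>src = P, tgt = DirIrr (Id_dir P), app = (\<lambda>p\<in>carrier P. down_set P p)\<rparr>"

lemma src_tgt_eta_eps [simp]: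
  "src (eta D) = D" "tgt (eta D) = Id_dir (DirIrr D)" "src (eps P) = P" "tgt (eps P) = DirIrr (Id_dir P)"
  by (simp_all add: eta_def eps_def)

text \<open>
  The inverse takes a directed lower set of irreducible elements to its join.
\<close>

lemma DirIrrPFrm_iso_eta:
  assumes "directedly_generated_preframe D"
  shows "DirIrrPFrm_iso (eta D)"
proof -
  interpret D: directedly_generated_preframe D by fact
  interpret I: order_isomorphism D "Id_dir (DirIrr D)" "down_set (DirIrr D)" "\<lambda>I. \<Squnion>\<^bsub>D\<^esub>I"
  proof
    show "down_set (DirIrr D) \<in> carrier D \<rightarrow> carrier (Id_dir (DirIrr D))"
      using D.irreducibles_below_Id_dir by blast
    show "(\<lambda>I. \<Squnion>\<^bsub>D\<^esub>I) \<in> carrier (Id_dir (DirIrr D)) \<rightarrow> carrier D"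
      using least_closed[OF D.is_lub_directed_sup] D.directed_DirIrr by simp
    show "down_set (DirIrr D) x \<sqsubseteq>\<^bsub>Id_dir (DirIrr D)\<^esub> down_set (DirIrr D) y \<longleftrightarrow> x \<sqsubseteq>\<^bsub>D\<^esub> y"
      if "x \<in> carrier D" "y \<in> carrier D" for x y
      unfolding D.le_iff_irreducibles[OF that] by (auto simp: down_set_def)
  qed (simp_all only: D.sup_irreducibles_below D.irreducibles_below_sup)
  have "Pos_dir_poset (DirIrr D)" using D.Pos_dir_obj_DirIrr by (simp add: Pos_dir_obj_poset)
  then have "DirIrrPFrm_iso I.iso_arrow"
    by (intro I.DirIrrPFrm_iso_iso_arrow assms Pos_dir_poset.directedly_generated_Id_dir)
  then show ?thesis by (simp add: I.iso_arrow_def eta_def)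
qed

lemma Pos_dir_iso_eps:
  assumes P: "Pos_dir_obj P"
  shows "Pos_dir_iso (eps P)"
proof -
  interpret P: Pos_dir_poset P using P by (simp add: Pos_dir_obj_poset)
  have inj: "inj_on (down_set P) (carrier P)"
    by (rule inj_onI) (metis P.down_set_le_iff P.le_antisym order_refl)
  have irr: "carrier (DirIrr (Id_dir P)) = down_set P ` carrier P"
    by (auto simp: P.irreducible_Id_dir_iff)
  interpret I: order_isomorphism P "DirIrr (Id_dir P)" "down_set P" "inv_into (carrier P) (down_set P)"
  proof
    show "down_set P \<in> carrier P \<rightarrow> carrier (DirIrr (Id_dir P))" unfolding irr by blast
    show "inv_into (carrier P) (down_set P) \<in> carrier (DirIrr (Id_dir P)) \<rightarrow> carrier P"
      unfolding irr using inv_into_into by (intro funcsetI)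
    show "inv_into (carrier P) (down_set P) (down_set P p) = p" if "p \<in> carrier P" for p
      using inv_into_f_f[OF inj that] .
    show "down_set P (inv_into (carrier P) (down_set P) I) = I" if "I \<in> carrier (DirIrr (Id_dir P))" for I
      using that unfolding irr by (rule f_inv_into_f)
    show "down_set P p \<sqsubseteq>\<^bsub>DirIrr (Id_dir P)\<^esub> down_set P q \<longleftrightarrow> p \<sqsubseteq>\<^bsub>P\<^esub> q"
      if "p \<in> carrier P" "q \<in> carrier P" for p q
      using P.down_set_le_iff[OF that] by simp
  qed
  have "Pos_dir_obj (DirIrr (Id_dir P))"
    by (rule directedly_generated_preframe.Pos_dir_obj_DirIrr[OF P.directedly_generated_Id_dir])
  then have "Pos_dir_iso I.iso_arrow" by (rule I.Pos_dir_iso_iso_arrow[OF P])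
  then show ?thesis by (simp add: I.iso_arrow_def eps_def)
qed

lemma eta_natural:
  assumes f: "DirIrrPFrm_arr f"
  shows "arrow_comp (eta (tgt f)) f = arrow_comp (E_arr (D_arr f)) (eta (src f))"
proof -
  note D = DirIrrPFrm_arrD[OF f]
  have "compose (carrier (src f)) (app (eta (tgt f))) (app f) =
      compose (carrier (src f)) (app (E_arr (D_arr f))) (app (eta (src f)))"
    unfolding compose_def
  proof (rule restrict_ext)
    fix d assume d: "d \<in> carrier (src f)"
    then have fd: "app f d \<in> carrier (tgt f)" using D(5) by blast
    have "down_set (DirIrr (src f)) d \<in> carrier (Id_dir (DirIrr (src f)))"
      by (rule directedly_generated_preframe.irreducibles_below_Id_dir[OF D(1) d])
    then show "app (eta (tgt f)) (app f d) = app (E_arr (D_arr f)) (app (eta (src f)) d)"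
      using d fd inverse_image_D_arr[OF f d] by (simp add: eta_def)
  qed
  then show ?thesis by (simp add: arrow_comp_def)
qed

lemma eps_natural:
  assumes g: "Pos_dir_arr g"
  shows "arrow_comp (eps (tgt g)) g = arrow_comp (D_arr (E_arr g)) (eps (src g))"
proof -
  note G = Pos_dir_arrD[OF g]
  interpret P: Pos_dir_poset "src g" using G(1) by (simp add: Pos_dir_obj_poset)
  \<comment> \<open>\<open>D(E(g))\<close> takes \<open>\<down>p\<close> to \<open>\<down>(g p)\<close>, by uniqueness of the adjoint.\<close>
  have DE: "app (D_arr (E_arr g)) =
      restrict (lower_image (tgt g) (app g)) (carrier (DirIrr (Id_dir (src g))))"
    using D_arr_eqI[OF DirIrrPFrm_arr_E_arr[OF g], of "lower_image (tgt g) (app g)"]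
      E_arr_irr_adjoint[OF g] by (simp del: app_E_arr)
  have "compose (carrier (src g)) (app (eps (tgt g))) (app g) =
      compose (carrier (src g)) (app (D_arr (E_arr g))) (app (eps (src g)))"
    unfolding compose_def
  proof (rule restrict_ext)
    fix p assume p: "p \<in> carrier (src g)"
    then have gp: "app g p \<in> carrier (tgt g)" using G(4) by blast
    have "directedly_irreducible (Id_dir (src g)) (down_set (src g) p)"
      using p by (auto simp: P.irreducible_Id_dir_iff)
    then show "app (eps (tgt g)) (app g p) = app (D_arr (E_arr g)) (app (eps (src g)) p)"
      unfolding DE using p gp lower_image_down_set[OF g p] by (simp add: eps_def)
  qed
  then show ?thesis by (simp add: arrow_comp_def)
qed

theorem theorem5p10:
  shows "category (DirIrrPFrm :: ('a gorder, ('a, 'a) arrow) category)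
    \<and> category (Pos_dir :: ('a gorder, ('a, 'a) arrow) category)
    \<and> (\<forall>f :: ('a, 'a) arrow. f \<in> Arr DirIrrPFrm \<longrightarrow>
         is_left_adjoint (Id_J (src f)) (Id_J (tgt f)) (A_map (tgt f) (app f)) (A_left_adjoint f) \<and>
         (\<forall>d'\<in>carrier (DirIrr (tgt f)).
            app (D_arr f) d' \<in> carrier (DirIrr (src f)) \<and>
            A_left_adjoint f (down_set (tgt f) d') = down_set (src f) (app (D_arr f) d')))
    \<and> cat_functor (op_cat DirIrrPFrm) Pos_dir
         (D_obj :: 'a gorder \<Rightarrow> 'a gorder) (D_arr :: ('a, 'a) arrow \<Rightarrow> ('a, 'a) arrow)
    \<and> cat_functor Pos_dir (op_cat DirIrrPFrm)
         (E_obj :: 'a gorder \<Rightarrow> 'a set gorder) (E_arr :: ('a, 'a) arrow \<Rightarrow> ('a set, 'a set) arrow)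
    \<and> (\<exists>\<eta> :: 'a gorder \<Rightarrow> ('a, 'a set) arrow.
         (\<forall>X\<in>Obj DirIrrPFrm. DirIrrPFrm_iso (\<eta> X) \<and>
            src (\<eta> X) = X \<and> tgt (\<eta> X) = E_obj (D_obj X)) \<and>
         (\<forall>f\<in>Arr DirIrrPFrm.
            arrow_comp (\<eta> (tgt f)) f = arrow_comp (E_arr (D_arr f)) (\<eta> (src f))))
    \<and> (\<exists>\<epsilon> :: 'a gorder \<Rightarrow> ('a, 'a set) arrow.
         (\<forall>P\<in>Obj Pos_dir. Pos_dir_iso (\<epsilon> P) \<and>
            src (\<epsilon> P) = P \<and> tgt (\<epsilon> P) = D_obj (E_obj P)) \<and>
         (\<forall>g\<in>Arr Pos_dir.
            arrow_comp (\<epsilon> (tgt g)) g = arrow_comp (D_arr (E_arr g)) (\<epsilon> (src g))))"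
proof (intro conjI)
  show "category (DirIrrPFrm :: ('a gorder, ('a, 'a) arrow) category)" by (rule category_DirIrrPFrm)
  show "category (Pos_dir :: ('a gorder, ('a, 'a) arrow) category)" by (rule category_Pos_dir)
  show "\<forall>f :: ('a, 'a) arrow. f \<in> Arr DirIrrPFrm \<longrightarrow>
      is_left_adjoint (Id_J (src f)) (Id_J (tgt f)) (A_map (tgt f) (app f)) (A_left_adjoint f) \<and>
      (\<forall>d'\<in>carrier (DirIrr (tgt f)).
         app (D_arr f) d' \<in> carrier (DirIrr (src f)) \<and>
         A_left_adjoint f (down_set (tgt f) d') = down_set (src f) (app (D_arr f) d'))"
    by (simp add: DirIrrPFrm_def A_left_adjoint_is_left_adjoint D_arr_principal)
  show "cat_functor (op_cat DirIrrPFrm) Pos_dir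
      (D_obj :: 'a gorder \<Rightarrow> 'a gorder) (D_arr :: ('a, 'a) arrow \<Rightarrow> ('a, 'a) arrow)"
    by (rule D_functor)
  show "cat_functor Pos_dir (op_cat DirIrrPFrm)
      (E_obj :: 'a gorder \<Rightarrow> 'a set gorder) (E_arr :: ('a, 'a) arrow \<Rightarrow> ('a set, 'a set) arrow)"
    by (rule E_functor)
  show "\<exists>\<eta> :: 'a gorder \<Rightarrow> ('a, 'a set) arrow.
      (\<forall>X\<in>Obj DirIrrPFrm. DirIrrPFrm_iso (\<eta> X) \<and> src (\<eta> X) = X \<and> tgt (\<eta> X) = E_obj (D_obj X)) \<and>
      (\<forall>f\<in>Arr DirIrrPFrm. arrow_comp (\<eta> (tgt f)) f = arrow_comp (E_arr (D_arr f)) (\<eta> (src f)))"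
    by (rule exI[of _ eta])
      (simp add: DirIrrPFrm_def DirIrrPFrm_obj_iff DirIrrPFrm_iso_eta eta_natural E_obj_def D_obj_def)
  show "\<exists>\<epsilon> :: 'a gorder \<Rightarrow> ('a, 'a set) arrow.
      (\<forall>P\<in>Obj Pos_dir. Pos_dir_iso (\<epsilon> P) \<and> src (\<epsilon> P) = P \<and> tgt (\<epsilon> P) = D_obj (E_obj P)) \<and>
      (\<forall>g\<in>Arr Pos_dir. arrow_comp (\<epsilon> (tgt g)) g = arrow_comp (D_arr (E_arr g)) (\<epsilon> (src g)))"
    by (rule exI[of _ eps])
      (simp add: Pos_dir_def Pos_dir_iso_eps eps_natural E_obj_def D_obj_def)
qed

end
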